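(* Fix $z\in\mathbb{C}\setminus\{0\}$. For $\alpha>0$ define $$K(z,\alpha):=\frac{\sqrt{\pi}}{z}\alpha^{-\frac14}e^{\frac{z^2}{8}}\operatorname{erf}\left(\frac{z}{2}\right)-\frac{4}{z}\alpha^{\frac14}e^{-\frac{z^2}{8}}\int_{-\infty}^{0}\frac{e^{-\alpha x^2}\sinh(\sqrt{\alpha}\, xz)}{e^{2\pi x}-1}\, dx.$$ Then, as $\alpha\to0^+$, $$K(z,\alpha)\sim\frac{2}{\sqrt{\pi}}\alpha^{-1/4}e^{z^2/8}\sum_{m=0}^{\infty}\left(\frac{-\alpha}{\pi^2}\right)^{m}\zeta(2m)\,\Gamma\left(m+\frac12\right){}_1F_1\left(m+\frac12;\frac32;\frac{-z^2}{4}\right).$$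
   Context: $\operatorname{erf}(z)=\frac{2}{\sqrt{\pi}}\int_0^z e^{-t^2}\,dt$; $\zeta$ is the Riemann zeta function (so $\zeta(0)=-1/2$); ${}_1F_1(a;c;w)$ is Kummer's confluent hypergeometric function. The asymptotic expansion is meant in the Poincaré sense as $\alpha\to0^+$. *)

theory Defs
  imports "HOL-Complex_Analysis.Complex_Analysis"
begin

definition complex_erf :: "complex \<Rightarrow> complex" where
  "complex_erf z =
     2 / complex_of_real (sqrt pi) * contour_integral (linepath 0 z) (\<lambda>t. exp (- (t ^ 2)))"

text \<open>
  The Riemann zeta function is the analytic continuation of the Dirichlet series to the
  complex plane without \<open>1\<close>. The description is unique by the identity theorem once
  the value at the pole is pinned down; it is set to \<open>0\<close>, which carries no meaning.
\<close>
definition riemann_zeta :: "complex \<Rightarrow> complex" where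
  "riemann_zeta = (THE f. f holomorphic_on - {1} \<and> f 1 = 0 \<and>
     (\<forall>s. Re s > 1 \<longrightarrow> f s = (\<Sum>n. of_nat (Suc n) powr (- s))))"

definition kummer_1F1 :: "complex \<Rightarrow> complex \<Rightarrow> complex \<Rightarrow> complex" where
  "kummer_1F1 a c w = eval_fps (fps_hypergeo [a] [c] 1) w"

text \<open>
  Asymptotic expansions in the sense of Poincare: \<open>f\<close> is asymptotic to the formal series
  of the terms \<open>a m * \<phi> m x\<close>, where \<open>\<phi>\<close> is an asymptotic scale along the filter \<open>F\<close>.
  The remainder after the term of index \<open>N\<close> is compared with \<open>\<phi> N\<close> and not with the term
  itself, so coefficients may vanish; the series need not converge.
\<close>
definition asymptotic_scale :: "'a filter \<Rightarrow> (nat \<Rightarrow> 'a \<Rightarrow> 'b::real_normed_field) \<Rightarrow> bool" where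
  "asymptotic_scale F \<phi> \<longleftrightarrow>
     (\<forall>m. eventually (\<lambda>x. \<phi> m x \<noteq> 0) F) \<and> (\<forall>m. \<phi> (Suc m) \<in> o[F](\<phi> m))"

definition poincare_expansion ::
  "'a filter \<Rightarrow> (nat \<Rightarrow> 'a \<Rightarrow> 'b::real_normed_field) \<Rightarrow> ('a \<Rightarrow> 'b) \<Rightarrow> (nat \<Rightarrow> 'b) \<Rightarrow> bool" where
  "poincare_expansion F \<phi> f a \<longleftrightarrow> asymptotic_scale F \<phi> \<and>
     (\<forall>N. (\<lambda>x. f x - (\<Sum>m\<le>N. a m * \<phi> m x)) \<in> o[F](\<phi> N))"

text \<open>
  The integrand is absolutely integrable: it extends continuously to \<open>x = 0\<close> and the
  Gaussian factor dominates at infinity.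
\<close>
definition K :: "complex \<Rightarrow> real \<Rightarrow> complex" where
  "K z \<alpha> =
     complex_of_real (sqrt pi) / z * complex_of_real (\<alpha> powr (- 1 / 4)) * exp (z ^ 2 / 8)
       * complex_erf (z / 2)
     - 4 / z * complex_of_real (\<alpha> powr (1 / 4)) * exp (- (z ^ 2) / 8)
       * (LINT x:{..0}|lborel.
            complex_of_real (exp (- \<alpha> * x ^ 2)) * sinh (complex_of_real (sqrt \<alpha> * x) * z)
              / complex_of_real (exp (2 * pi * x) - 1))"

end

theory Submission
  imports Defs "HOL-Probability.Distributions" "HOL-Real_Asymp.Real_Asymp"
begin

text \<open>
  Substituting \<open>x = - y\<close> and using \<open>- 1 / (exp (- 2 \<pi> y) - 1) = 1 + 1 / (exp (2 \<pi> y) - 1)\<close>, the integral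
  in \<open>K\<close> splits into a Gaussian integral, which combines with the error function term and gives the
  term \<open>m = 0\<close>, and the Planck integral of \<open>h (sqrt \<alpha> * y) / (exp (2 \<pi> y) - 1)\<close> where
  \<open>h u = exp (- u\<^sup>2) * sinh (u * z)\<close>. The Taylor polynomials of \<open>h\<close> approximate it with an error bounded by
  a power of \<open>u\<close> on all of \<open>u \<ge> 0\<close>, so the Planck integral may be expanded termwise; the moments of
  \<open>1 / (exp (2 \<pi> y) - 1)\<close> are even zeta values. The Taylor coefficients of \<open>h\<close> are terminating
  Kummer series, and Kummer's transformation together with the duplication of \<open>\<Gamma>\<close> at half integers puts
  them in the stated form.
\<close>

section \<open>Continuation of the Riemann zeta function\<close>

text \<open>
  The function \<open>g s = (s - 1) * \<zeta> s\<close> satisfies a recursion expressing \<open>g s\<close> through \<open>g (s + 1)\<close>, ...,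
  \<open>g (s + M - 1)\<close> and a series that converges for \<open>Re s > 1 - M\<close>. It yields the continuation of \<open>g\<close> to
  larger and larger half-planes, and also the values \<open>g 1 = 1\<close> and \<open>g 0 = 1 / 2\<close>, since the series
  vanishes there.
\<close>

lemma powr_binomial_remainder:
  fixes a :: complex and x :: real
  assumes x: "0 \<le> x" "x \<le> 1" and a: "norm a \<le> A"
  shows "norm ((1 + of_real x) powr a - (\<Sum>k\<le>M. (a gchoose k) * of_real x ^ k))
           \<le> (\<Prod>j\<le>M. A + real j) * 2 powr (A + real (Suc M)) / fact M * x ^ Suc M"
proof -
  define S where "S = closed_segment (0::complex) 1"
  define f where "f = (\<lambda>i w. (\<Prod>j<i. a - of_nat j) * (1 + w) powr (a - of_nat i))"
  define B where "B = (\<Prod>j\<le>M. A + real j) * 2 powr (A + real (Suc M))"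
  have S: "\<exists>t. w = of_real t \<and> 0 \<le> t \<and> t \<le> 1" if "w \<in> S" for w
    using that by (auto simp: S_def in_segment scaleR_conv_of_real)
  have A: "A \<ge> 0" using a norm_ge_zero order_trans by blast
  have "norm (f 0 (of_real x) - (\<Sum>i\<le>M. f i 0 * (of_real x - 0) ^ i / fact i))
        \<le> B * norm (of_real x - (0::complex)) ^ Suc M / fact M"
  proof (rule complex_Taylor[of S])
    show "convex S" by (simp add: S_def)
    show "0 \<in> S" by (simp add: S_def)
    show "complex_of_real x \<in> S"
      using x by (auto simp: S_def in_segment scaleR_conv_of_real)
  next
    fix i w assume "w \<in> S"
    then obtain t where t: "w = of_real t" "0 \<le> t" "t \<le> 1" using S by blast
    have "1 + w \<notin> \<real>\<^sub>\<le>\<^sub>0" using t by (auto simp: complex_nonpos_Reals_iff)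
    then show "(f i has_field_derivative f (Suc i) w) (at w within S)"
      unfolding f_def by (auto intro!: derivative_eq_intros simp: algebra_simps)
  next
    fix w assume "w \<in> S"
    then obtain t where t: "w = of_real t" "0 \<le> t" "t \<le> 1" using S by blast
    have e: "1 + w = of_real (1 + t)" by (simp add: t)
    have "norm ((1 + w) powr (a - of_nat (Suc M))) = (1 + t) powr (Re a - real (Suc M))"
      unfolding e using t by (subst norm_powr_real_powr) auto
    \<comment> \<open>The exponent is raised to a nonnegative one so that the base, which lies
      between 1 and 2, can then be replaced by 2.\<close>
    also have "\<dots> \<le> (1 + t) powr (A + real (Suc M))"
      using t a complex_Re_le_cmod[of a] by (intro powr_mono) auto
    also have "\<dots> \<le> 2 powr (A + real (Suc M))"
      using t A by (intro powr_mono2) auto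
    finally have 1: "norm ((1 + w) powr (a - of_nat (Suc M))) \<le> 2 powr (A + real (Suc M))" .
    have 2: "norm (\<Prod>j<Suc M. a - of_nat j) \<le> (\<Prod>j\<le>M. A + real j)"
      unfolding prod_norm[symmetric] lessThan_Suc_atMost
    proof (intro prod_mono conjI)
      fix j
      show "norm (a - of_nat j) \<le> A + real j"
        using norm_triangle_ineq4[of a "of_nat j"] a by simp
    qed simp
    show "norm (f (Suc M) w) \<le> B"
      unfolding f_def B_def norm_mult
      using 1 2 A by (intro mult_mono) (auto intro!: prod_nonneg)
  qed
  also have "f 0 (of_real x) = (1 + of_real x) powr a" by (simp add: f_def)
  also have "(\<Sum>i\<le>M. f i 0 * (of_real x - 0) ^ i / fact i) = (\<Sum>k\<le>M. (a gchoose k) * of_real x ^ k)"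
    by (intro sum.cong) (simp_all add: f_def gbinomial_prod_rev atLeast0LessThan)
  finally show ?thesis using x by (simp add: B_def)
qed

definition zeta_series :: "complex \<Rightarrow> complex" where
  "zeta_series s = (\<Sum>n. of_nat (Suc n) powr (- s))"

text \<open>With N = n + 1, this is what remains of (N + 1) powr (1 - s) after M + 1 terms of its
  expansion in descending powers of N.\<close>

definition binomial_remainder :: "nat \<Rightarrow> nat \<Rightarrow> complex \<Rightarrow> complex" where
  "binomial_remainder M n s = of_nat (Suc (Suc n)) powr (1 - s)
     - (\<Sum>k\<le>M. ((1 - s) gchoose k) * of_nat (Suc n) powr (1 - s - of_nat k))"

lemma norm_of_nat_Suc_powr: "norm (of_nat (Suc n) powr s) = real (Suc n) powr Re s"
  by (metis norm_powr_real_powr of_nat_0_le_iff of_real_of_nat_eq Re_complex_of_real Reals_of_nat)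

text \<open>Once N powr (1 - s) is factored out, with N = n + 1, the rest is the remainder of the
  binomial series at x = 1 / N, which contributes the decay x ^ (M + 1).\<close>

lemma binomial_remainder_bound:
  assumes "norm (1 - s) \<le> A"
  shows "norm (binomial_remainder M n s) \<le>
    (\<Prod>j\<le>M. A + real j) * 2 powr (A + real (Suc M)) / fact M * real (Suc n) powr (- Re s - real M)"
proof -
  define N where "N = real (Suc n)"
  define x where "x = 1 / N"
  have N: "N \<ge> 1" by (simp add: N_def)
  have cN: "of_nat (Suc n) = complex_of_real N" by (simp add: N_def)
  have e1: "of_nat (Suc (Suc n)) = complex_of_real N * complex_of_real (1 + x)"
    using N by (simp add: x_def field_simps flip: of_real_mult of_real_add) (simp add: N_def algebra_simps)
  have e1: "of_nat (Suc (Suc n)) powr (1 - s)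
      = of_real N powr (1 - s) * (1 + of_real x) powr (1 - s)"
    unfolding e1 using N by (subst powr_times_real) (auto simp: x_def)
  have e2: "of_real N powr (1 - s - of_nat k) = of_real N powr (1 - s) * of_real x ^ k" for k
    unfolding powr_diff using N by (simp add: powr_nat x_def power_divide)
  have "binomial_remainder M n s = of_real N powr (1 - s) *
     ((1 + of_real x) powr (1 - s) - (\<Sum>k\<le>M. ((1 - s) gchoose k) * of_real x ^ k))"
    unfolding binomial_remainder_def e1 cN e2
    by (simp add: algebra_simps sum_distrib_left)
  then have "norm (binomial_remainder M n s) = N powr (1 - Re s) *
     norm ((1 + of_real x) powr (1 - s) - (\<Sum>k\<le>M. ((1 - s) gchoose k) * of_real x ^ k))"
    using norm_of_nat_Suc_powr[of n "1 - s"] by (simp add: norm_mult cN N_def)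
  also have "\<dots> \<le> N powr (1 - Re s) *
     ((\<Prod>j\<le>M. A + real j) * 2 powr (A + real (Suc M)) / fact M * x ^ Suc M)"
    using N assms by (intro mult_left_mono powr_binomial_remainder) (auto simp: x_def)
  also have "\<dots> = (\<Prod>j\<le>M. A + real j) * 2 powr (A + real (Suc M)) / fact M
     * (N powr (1 - Re s) * x ^ Suc M)" by simp
  also have "x ^ Suc M = N powr (- real (Suc M))"
    using N by (simp add: x_def powr_minus powr_realpow field_simps power_divide del: power_Suc of_nat_Suc)
  also have "N powr (1 - Re s) * N powr (- real (Suc M)) = N powr (- Re s - real M)"
    using N by (simp add: powr_add[symmetric])
  finally show ?thesis by (simp add: N_def)
qed

lemma summable_Suc_powr:
  assumes "b < -1"
  shows "summable (\<lambda>n. real (Suc n) powr b)"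
proof -
  have "summable (\<lambda>n. real n powr b)" using assms by (simp add: summable_real_powr_iff)
  then show ?thesis by (subst summable_Suc_iff)
qed

lemma summable_binomial_remainder:
  assumes "Re s > 1 - real M"
  shows "summable (\<lambda>n. binomial_remainder M n s)"
proof (rule summable_comparison_test')
  show "summable (\<lambda>n. (\<Prod>j\<le>M. norm (1 - s) + real j) * 2 powr (norm (1 - s) + real (Suc M)) / fact M
      * real (Suc n) powr (- Re s - real M))"
    using assms by (intro summable_mult summable_Suc_powr) simp
  show "norm (binomial_remainder M n s) \<le> (\<Prod>j\<le>M. norm (1 - s) + real j)
      * 2 powr (norm (1 - s) + real (Suc M)) / fact M * real (Suc n) powr (- Re s - real M)"
    if "n \<ge> 0" for n by (rule binomial_remainder_bound) simp
qed

lemma holomorphic_binomial_remainder_sum: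
  "(\<lambda>s. \<Sum>n. binomial_remainder M n s) holomorphic_on {s. Re s > 1 - real M}"
proof (rule holomorphic_uniform_sequence)
  show "open {s. Re s > 1 - real M}" by (rule open_halfspace_Re_gt)
  show "(\<lambda>s. \<Sum>n<k. binomial_remainder M n s) holomorphic_on {s. Re s > 1 - real M}" for k
    unfolding binomial_remainder_def gbinomial_prod_rev
    by (intro holomorphic_intros) (auto simp: complex_nonpos_Reals_iff simp del: of_nat_Suc)
next
  fix s0 assume "s0 \<in> {s. Re s > 1 - real M}"
  then have s0: "Re s0 > 1 - real M" by simp
  \<comment> \<open>Half the distance from \<open>s0\<close> to the boundary line: on the closed
    ball \<open>Re s + real M\<close> stays at least 1 + d, so the terms are dominated by a multiple
    of N powr (- 1 - d), N = n + 1.\<close>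
  define d where "d = (Re s0 - 1 + real M) / 2"
  define A where "A = norm (1 - s0) + d"
  have d: "d > 0" using s0 by (simp add: d_def)
  have ge: "Re s \<ge> 1 - real M + d" "norm (1 - s) \<le> A" if "s \<in> cball s0 d" for s
  proof -
    have n: "norm (s0 - s) \<le> d" using that by (simp add: dist_norm)
    have "Re s0 - Re s \<le> d" using complex_Re_le_cmod[of "s0 - s"] n by simp
    then show "Re s \<ge> 1 - real M + d" by (simp add: d_def field_simps)
    have "norm (1 - s) \<le> norm (1 - s0) + norm (s0 - s)"
      using norm_triangle_ineq[of "1 - s0" "s0 - s"] by simp
    then show "norm (1 - s) \<le> A" using n by (simp add: A_def)
  qed
  have "uniform_limit (cball s0 d) (\<lambda>k s. \<Sum>n<k. binomial_remainder M n s)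
           (\<lambda>s. \<Sum>n. binomial_remainder M n s) sequentially"
  proof (rule Weierstrass_m_test)
    show "summable (\<lambda>n. (\<Prod>j\<le>M. A + real j) * 2 powr (A + real (Suc M)) / fact M
        * real (Suc n) powr (- 1 - d))"
      using d by (intro summable_mult summable_Suc_powr) simp
    fix n s assume s: "s \<in> cball s0 d"
    have A: "A \<ge> 0" using d by (simp add: A_def)
    have "norm (binomial_remainder M n s) \<le> (\<Prod>j\<le>M. A + real j) * 2 powr (A + real (Suc M)) / fact M
        * real (Suc n) powr (- Re s - real M)"
      by (rule binomial_remainder_bound[OF ge(2)[OF s]])
    also have "\<dots> \<le> (\<Prod>j\<le>M. A + real j) * 2 powr (A + real (Suc M)) / fact M
        * real (Suc n) powr (- 1 - d)"
      using ge(1)[OF s] A by (intro mult_left_mono powr_mono mult_nonneg_nonneg divide_nonneg_nonneg prod_nonneg) auto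
    finally show "norm (binomial_remainder M n s) \<le> (\<Prod>j\<le>M. A + real j) * 2 powr (A + real (Suc M)) / fact M
        * real (Suc n) powr (- 1 - d)" .
  qed
  moreover have "cball s0 d \<subseteq> {s. Re s > 1 - real M}"
    using ge(1) d by force
  ultimately show "\<exists>d>0. cball s0 d \<subseteq> {s. Re s > 1 - real M} \<and>
      uniform_limit (cball s0 d) (\<lambda>k s. \<Sum>n<k. binomial_remainder M n s)
           (\<lambda>s. \<Sum>n. binomial_remainder M n s) sequentially"
    using d by blast
qed

lemma zeta_series_sums:
  assumes "Re s > 1"
  shows "(\<lambda>n. of_nat (Suc n) powr (- s)) sums zeta_series s"
proof -
  have "summable (\<lambda>n. norm (of_nat (Suc n) powr (- s)))"
    unfolding norm_of_nat_Suc_powr using assms by (intro summable_Suc_powr) simp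
  then show ?thesis
    unfolding zeta_series_def by (rule summable_sums[OF summable_norm_cancel])
qed

text \<open>Expanding \<open>(n + 2) powr (1 - s)\<close> by the binomial series around \<open>n + 1\<close> and telescoping.\<close>

lemma zeta_series_recursion:
  assumes s: "Re s > 1"
  shows "(\<Sum>j<M. ((1 - s) gchoose j) / of_nat (Suc j) * ((s + of_nat j - 1) * zeta_series (s + of_nat j)))
           = 1 + (\<Sum>n. binomial_remainder M n s)"
proof -
  have "(\<lambda>n. of_nat (Suc n) powr (1 - s)) \<longlonglongrightarrow> 0"
  proof (rule tendsto_norm_zero_cancel)
    have "(\<lambda>n. real n powr (1 - Re s)) \<longlonglongrightarrow> 0"
      using s by (intro tendsto_neg_powr filterlim_real_sequentially) simp
    then have "(\<lambda>n. real (Suc n) powr (1 - Re s)) \<longlonglongrightarrow> 0" by (rule LIMSEQ_Suc)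
    then show "(\<lambda>n. norm (of_nat (Suc n) powr (1 - s))) \<longlonglongrightarrow> 0"
      by (simp add: norm_of_nat_Suc_powr del: of_nat_Suc)
  qed
  from telescope_sums[OF this]
  have 1: "(\<lambda>n. of_nat (Suc (Suc n)) powr (1 - s) - of_nat (Suc n) powr (1 - s)) sums (- 1)" by simp
  have 2: "(\<lambda>n. (\<Sum>j<M. ((1 - s) gchoose Suc j) * of_nat (Suc n) powr (- (s + of_nat j)))
     + binomial_remainder M n s)
     sums ((\<Sum>j<M. ((1 - s) gchoose Suc j) * zeta_series (s + of_nat j)) + (\<Sum>n. binomial_remainder M n s))"
    using s by (intro sums_add sums_sum sums_mult zeta_series_sums summable_sums
        summable_binomial_remainder) auto
  have "(\<Sum>j<M. ((1 - s) gchoose Suc j) * of_nat (Suc n) powr (- (s + of_nat j)))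
     + binomial_remainder M n s = of_nat (Suc (Suc n)) powr (1 - s) - of_nat (Suc n) powr (1 - s)" for n
  proof -
    have "(\<Sum>k\<le>M. ((1 - s) gchoose k) * of_nat (Suc n) powr (1 - s - of_nat k))
      = of_nat (Suc n) powr (1 - s) + (\<Sum>j<M. ((1 - s) gchoose Suc j) * of_nat (Suc n) powr (1 - s - of_nat (Suc j)))"
      by (subst sum.atMost_shift) (simp del: of_nat_Suc)
    moreover have "1 - s - of_nat (Suc j) = - (s + of_nat j)" for j by simp
    ultimately show ?thesis by (simp add: binomial_remainder_def del: of_nat_Suc)
  qed
  with 2 have "(\<lambda>n. of_nat (Suc (Suc n)) powr (1 - s) - of_nat (Suc n) powr (1 - s)) sums
     ((\<Sum>j<M. ((1 - s) gchoose Suc j) * zeta_series (s + of_nat j)) + (\<Sum>n. binomial_remainder M n s))"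
    by simp
  from sums_unique2[OF 1 this]
  have 3: "(\<Sum>j<M. ((1 - s) gchoose Suc j) * zeta_series (s + of_nat j)) = - 1 - (\<Sum>n. binomial_remainder M n s)"
    by (simp add: algebra_simps)
  \<comment> \<open>The factor 1 - s - j split off from the binomial coefficient of index j + 1 is
    the one that cancels the pole of \<zeta>(s + j), so the recursion is one for (s - 1) \<zeta>(s)
    alone.\<close>
  have "((1 - s) gchoose j) / of_nat (Suc j) * ((s + of_nat j - 1) * zeta_series (s + of_nat j))
      = - (((1 - s) gchoose Suc j) * zeta_series (s + of_nat j))" for j
  proof -
    have 1: "((1 - s) gchoose Suc j) = (1 - s - of_nat j) * ((1 - s) gchoose j) / of_nat (Suc j)"
      by (simp add: gbinomial_prod_rev mult_ac del: of_nat_Suc)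
    have 2: "s + of_nat j - 1 = - (1 - s - of_nat j)" by simp
    show ?thesis unfolding 1 2
      by (simp only: mult_minus_left mult_minus_right times_divide_eq_left times_divide_eq_right mult_ac)
  qed
  then show ?thesis by (simp add: sum_negf 3)
qed

section \<open>Continuation of (s - 1) \<zeta>(s) to the whole plane\<close>

lemma holomorphic_gbinomial: "(\<lambda>s. (1 - s) gchoose k) holomorphic_on A" for A :: "complex set"
  unfolding gbinomial_prod_rev by (intro holomorphic_intros) auto

text \<open>Each induction step gains a strip of width 1. In the recursion with M + 1 terms, the
  term j = 0 is (s - 1) \<zeta>(s) itself and the others involve only s + 1, ..., s + M, which
  already lie in the previous half-plane.\<close>

lemma zeta_continuation_halfplane:
  "\<exists>g. g holomorphic_on {s. Re s > 1 - real M} \<and> (\<forall>s. Re s > 1 \<longrightarrow> g s = (s - 1) * zeta_series s)"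
proof (induction M)
  case 0
  \<comment> \<open>Holomorphy of the Dirichlet series itself is read off from the recursion with a
    single term.\<close>
  have "(\<lambda>s. 1 + (\<Sum>n. binomial_remainder 1 n s)) holomorphic_on {s. Re s > 1 - real 0}"
    by (intro holomorphic_intros holomorphic_on_subset[OF holomorphic_binomial_remainder_sum]) auto
  moreover have "1 + (\<Sum>n. binomial_remainder 1 n s) = (s - 1) * zeta_series s" if "Re s > 1" for s
    using zeta_series_recursion[OF that, of 1] by simp
  ultimately show ?case by blast
next
  case (Suc M)
  then obtain g where g: "g holomorphic_on {s. Re s > 1 - real M}"
    and gz: "\<And>s. Re s > 1 \<Longrightarrow> g s = (s - 1) * zeta_series s" by blast
  define h where "h = (\<lambda>s. 1 + (\<Sum>n. binomial_remainder (Suc M) n s)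
     - (\<Sum>j<M. ((1 - s) gchoose Suc j) / of_nat (Suc (Suc j)) * g (s + of_nat (Suc j))))"
  have "h holomorphic_on {s. Re s > 1 - real (Suc M)}"
    unfolding h_def
  proof (intro holomorphic_intros holomorphic_binomial_remainder_sum holomorphic_gbinomial)
    fix j
    show "(\<lambda>s. g (s + of_nat (Suc j))) holomorphic_on {s. Re s > 1 - real (Suc M)}"
      by (rule holomorphic_on_compose_gen[OF _ g, unfolded o_def]) (auto intro!: holomorphic_intros)
  qed (simp_all del: of_nat_Suc)
  moreover have "h s = (s - 1) * zeta_series s" if s: "Re s > 1" for s
  proof -
    have "g (s + of_nat (Suc j)) = (s + of_nat (Suc j) - 1) * zeta_series (s + of_nat (Suc j))" for j
      using s by (intro gz) simp
    then have "h s = 1 + (\<Sum>n. binomial_remainder (Suc M) n s)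
       - (\<Sum>j<M. ((1 - s) gchoose Suc j) / of_nat (Suc (Suc j))
            * ((s + of_nat (Suc j) - 1) * zeta_series (s + of_nat (Suc j))))"
      by (simp only: h_def)
    also have "\<dots> = (s - 1) * zeta_series s"
      unfolding zeta_series_recursion[OF s, of "Suc M", symmetric] sum.lessThan_Suc_shift by simp
    finally show ?thesis .
  qed
  ultimately show ?case by blast
qed

text \<open>The continuations to the half-planes \<open>H M\<close> agree on overlaps by the
  identity theorem, since they all agree on \<open>H 0\<close>. They therefore glue to a function on
  the union, which is the whole plane.\<close>

lemma zeta_continuation_entire:
  "\<exists>g. g holomorphic_on UNIV \<and> (\<forall>s. Re s > 1 \<longrightarrow> g s = (s - 1) * zeta_series s)"
proof -
  define H where "H = (\<lambda>M::nat. {s::complex. Re s > 1 - real M})"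
  obtain g where g: "\<And>M. g M holomorphic_on H M"
    and gz: "\<And>M s. Re s > 1 \<Longrightarrow> g M s = (s - 1) * zeta_series s"
    using zeta_continuation_halfplane unfolding H_def by metis
  have openH: "open (H M)" and connH: "connected (H M)" for M
    unfolding H_def by (intro open_halfspace_Re_gt convex_connected convex_halfspace_Re_gt)+
  have agree_le: "g M s = g N s" if "M \<le> N" "s \<in> H M" for M N s
  proof (rule analytic_continuation_open[of "H 0" "H M" "g M" "g N"])
    show "H 0 \<noteq> {}" by (auto simp: H_def intro!: exI[of _ 2])
    show "g N holomorphic_on H M"
      by (rule holomorphic_on_subset[OF g]) (use that in \<open>auto simp: H_def\<close>)
    show "H 0 \<subseteq> H M" by (auto simp: H_def)
    show "g M s = g N s" if "s \<in> H 0" for s using that by (simp add: H_def gz)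
  qed (use that g openH connH in auto)
  have agree: "g M s = g N s" if "s \<in> H M" "s \<in> H N" for M N s
    using nat_le_linear[of M N]
  proof
    assume "M \<le> N" then show ?thesis using that(1) by (rule agree_le)
  next
    assume "N \<le> M" then show ?thesis using that(2) by (rule agree_le[symmetric])
  qed
  define G where "G = (\<lambda>s. g (SOME M. s \<in> H M) s)"
  have cover: "(\<Union>M. H M) = UNIV"
  proof -
    have "\<exists>M. s \<in> H M" for s
      using reals_Archimedean2[of "1 - Re s"] by (auto simp: H_def field_simps)
    then show ?thesis by auto
  qed
  have G: "G s = g M s" if "s \<in> H M" for s M
    unfolding G_def by (rule agree[OF someI[of "\<lambda>M. s \<in> H M"] that]) (rule that)
  have "G holomorphic_on (\<Union>M. H M)"
  proof (rule holomorphic_on_UN_open)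
    show "G holomorphic_on H M" for M
      by (rule holomorphic_transform[OF g]) (simp add: G)
  qed (rule openH)
  moreover have "G s = (s - 1) * zeta_series s" if "Re s > 1" for s
    using G[of s 0] gz[OF that, of 0] that by (simp add: H_def)
  ultimately show ?thesis unfolding cover by blast
qed

definition zeta_pole_free :: "complex \<Rightarrow> complex" where
  "zeta_pole_free = (SOME g. g holomorphic_on UNIV \<and> (\<forall>s. Re s > 1 \<longrightarrow> g s = (s - 1) * zeta_series s))"

lemma zeta_pole_free:
  shows holomorphic_zeta_pole_free: "zeta_pole_free holomorphic_on UNIV"
    and zeta_pole_free_eq: "\<And>s. Re s > 1 \<Longrightarrow> zeta_pole_free s = (s - 1) * zeta_series s"
  using someI_ex[OF zeta_continuation_entire] unfolding zeta_pole_free_def by blast+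

text \<open>Both sides are holomorphic on the larger half-plane, so the identity extends from
  \<open>Re s > 1\<close>. This permits evaluation at s = 1 and s = 0.\<close>

lemma zeta_pole_free_recursion:
  assumes "Re s > 1 - real M"
  shows "(\<Sum>j<M. ((1 - s) gchoose j) / of_nat (Suc j) * zeta_pole_free (s + of_nat j))
           = 1 + (\<Sum>n. binomial_remainder M n s)"
proof (rule analytic_continuation_open[of "{s. Re s > 1}" "{s. Re s > 1 - real M}"
    "\<lambda>s. \<Sum>j<M. ((1 - s) gchoose j) / of_nat (Suc j) * zeta_pole_free (s + of_nat j)"
    "\<lambda>s. 1 + (\<Sum>n. binomial_remainder M n s)"])
  show "(\<lambda>s. \<Sum>j<M. ((1 - s) gchoose j) / of_nat (Suc j) * zeta_pole_free (s + of_nat j))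
          holomorphic_on {s. Re s > 1 - real M}"
  proof (intro holomorphic_intros holomorphic_gbinomial)
    show "(\<lambda>s. zeta_pole_free (s + of_nat j)) holomorphic_on {s. Re s > 1 - real M}" for j
      by (rule holomorphic_on_compose_gen[OF _ holomorphic_zeta_pole_free, unfolded o_def])
        (auto intro!: holomorphic_intros)
  qed (simp del: of_nat_Suc)
  show "(\<lambda>s. 1 + (\<Sum>n. binomial_remainder M n s)) holomorphic_on {s. Re s > 1 - real M}"
    by (intro holomorphic_intros holomorphic_binomial_remainder_sum)
  show "connected {s. Re s > 1 - real M}"
    by (intro convex_connected convex_halfspace_Re_gt)
  show "{s. Re s > 1} \<noteq> {}" by (auto intro!: exI[of _ 2])
  fix s assume "s \<in> {s. Re s > 1}"
  then show "(\<Sum>j<M. ((1 - s) gchoose j) / of_nat (Suc j) * zeta_pole_free (s + of_nat j))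
           = 1 + (\<Sum>n. binomial_remainder M n s)"
    by (simp add: zeta_series_recursion[symmetric] zeta_pole_free_eq del: of_nat_Suc)
qed (use assms in \<open>auto simp: open_halfspace_Re_gt\<close>)

text \<open>The exponent 1 - s is 0, so every remainder vanishes and the recursion with one term is
  the claim.\<close>

lemma zeta_pole_free_1: "zeta_pole_free 1 = 1"
proof -
  have "binomial_remainder 1 n 1 = 0" for n
    by (simp add: binomial_remainder_def del: of_nat_Suc)
  then show ?thesis using zeta_pole_free_recursion[of 1 1] by simp
qed

text \<open>The expansion n + 2 = (n + 1) + 1 is exact, so the remainders vanish and the recursion
  reads g 0 + g 1 / 2 = 1. Two terms are the least number whose half-plane contains 0.\<close>

lemma zeta_pole_free_0: "zeta_pole_free 0 = 1 / 2"
proof -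
  have "binomial_remainder 2 n 0 = 0" for n
    using of_nat_neq_0[of n, where 'a = complex]
    by (simp add: binomial_remainder_def numeral_2_eq_2 gbinomial_prod_rev)
  then show ?thesis using zeta_pole_free_recursion[of 2 0]
    by (simp add: numeral_2_eq_2 zeta_pole_free_1 field_simps)
qed

text \<open>Uniqueness for the definite description is the identity theorem on the punctured plane,
  which is connected.\<close>

lemma riemann_zeta_eq: "riemann_zeta s = (if s = 1 then 0 else zeta_pole_free s / (s - 1))"
proof -
  define f where "f = (\<lambda>s. if s = 1 then 0 else zeta_pole_free s / (s - 1))"
  have "riemann_zeta = f"
    unfolding riemann_zeta_def
  proof (rule the_equality)
    have "(\<lambda>s. zeta_pole_free s / (s - 1)) holomorphic_on - {1}"
      by (intro holomorphic_intros holomorphic_on_subset[OF holomorphic_zeta_pole_free]) auto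
    then have f: "f holomorphic_on - {1}"
      by (rule holomorphic_transform) (simp add: f_def)
    have fz: "f s = (\<Sum>n. of_nat (Suc n) powr (- s))" if "Re s > 1" for s
    proof -
      have "s \<noteq> 1" using that by auto
      with that show ?thesis unfolding f_def by (simp add: zeta_pole_free_eq zeta_series_def)
    qed
    show "f holomorphic_on - {1} \<and> f 1 = 0 \<and> (\<forall>s. Re s > 1 \<longrightarrow> f s = (\<Sum>n. of_nat (Suc n) powr (- s)))"
      using f fz by (simp add: f_def)
    fix h assume h: "h holomorphic_on - {1} \<and> h 1 = 0 \<and>
      (\<forall>s. Re s > 1 \<longrightarrow> h s = (\<Sum>n. of_nat (Suc n) powr (- s)))"
    show "h = f"
    proof
      fix s
      show "h s = f s"
      proof (cases "s = 1")
        case True then show ?thesis using h by (simp add: f_def)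
      next
        case False
        show ?thesis
        proof (rule analytic_continuation_open[of "{s. Re s > 1}" "- {1}" h f])
          show "connected (- {1 :: complex})"
            using connected_punctured_universe[of "1 :: complex"] by (simp add: Compl_eq_Diff_UNIV)
          show "{s. Re s > 1} \<noteq> {}" by (auto intro!: exI[of _ 2])
        qed (use h f fz False in \<open>auto simp: open_halfspace_Re_gt\<close>)
      qed
    qed
  qed
  then show ?thesis unfolding f_def by (rule fun_cong)
qed

lemma riemann_zeta_0: "riemann_zeta 0 = - 1 / 2"
  by (simp add: riemann_zeta_eq zeta_pole_free_0)

lemma riemann_zeta_even_sums:
  assumes "m > 0"
  shows "(\<lambda>n. complex_of_real (1 / real (Suc n) ^ (2 * m))) sums riemann_zeta (of_nat (2 * m))"
proof -
  have "riemann_zeta (of_nat (2 * m)) = zeta_series (of_nat (2 * m))"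
  proof -
    have "of_nat (2 * m) \<noteq> (1 :: complex)" by (metis of_nat_1 of_nat_eq_iff odd_one even_mult_iff even_numeral)
    then show ?thesis unfolding riemann_zeta_eq using assms
      by (simp add: zeta_pole_free_eq)
  qed
  moreover have "of_nat (Suc n) powr (- of_nat (2 * m)) = complex_of_real (1 / real (Suc n) ^ (2 * m))" for n
    by (simp add: powr_minus powr_nat' field_simps del: of_nat_Suc of_nat_mult)
  ultimately show ?thesis
    using zeta_series_sums[of "of_nat (2 * m)"] assms by simp
qed

section \<open>Kummer's function and the error function\<close>

text \<open>Ratio test: consecutive terms have the quotient (a + n) t w / ((c + n) (n + 1)), which
  tends to 0 for every w.\<close>

lemma fps_conv_radius_hypergeo_1_1:
  fixes a c t :: complex
  assumes c: "c \<notin> \<int>\<^sub>\<le>\<^sub>0"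
  shows "fps_conv_radius (fps_hypergeo [a] [c] t) = \<infinity>"
  unfolding fps_conv_radius_def
proof (rule conv_radius_inftyI'')
  fix w :: complex
  define f where "f = (\<lambda>n. fps_nth (fps_hypergeo [a] [c] t) n * w ^ n)"
  have "(\<lambda>n. (real n + norm a) / ((real n - norm c) * (real n + 1))) \<longlonglongrightarrow> 0"
    by real_asymp
  then have "(\<lambda>n. (real n + norm a) / ((real n - norm c) * (real n + 1)) * norm (t * w)) \<longlonglongrightarrow> 0"
    by (rule tendsto_mult_left_zero)
  then have "eventually (\<lambda>n. (real n + norm a) / ((real n - norm c) * (real n + 1)) * norm (t * w) < 1 / 2) sequentially"
    by (rule order_tendstoD) simp
  moreover have "eventually (\<lambda>n. real n > norm c) sequentially" by real_asymp
  ultimately have "eventually (\<lambda>n. norm (f (Suc n)) \<le> 1 / 2 * norm (f n)) sequentially"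
  proof eventually_elim
    case (elim n)
    have "norm (f (Suc n)) = norm (a + of_nat n) / (norm (c + of_nat n) * (real n + 1)) * norm (t * w) * norm (f n)"
    proof -
      have "norm (1 + of_nat n :: complex) = real n + 1"
        by (metis norm_of_nat of_nat_Suc add.commute)
      then show ?thesis
        by (simp add: f_def pochhammer_Suc norm_mult norm_divide norm_power mult_ac)
    qed
    also have "\<dots> \<le> (real n + norm a) / ((real n - norm c) * (real n + 1)) * norm (t * w) * norm (f n)"
    proof (intro mult_right_mono frac_le mult_nonneg_nonneg)
      show "norm (a + of_nat n) \<le> real n + norm a"
        using norm_triangle_ineq[of a "of_nat n"] by simp
      show "real n - norm c \<le> norm (c + of_nat n)"
        using norm_triangle_ineq4[of "c + of_nat n" c] by simp
    qed (use elim in auto)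
    also have "\<dots> \<le> 1 / 2 * norm (f n)"
      using elim by (intro mult_right_mono) auto
    finally show ?case .
  qed
  then obtain N where "\<And>n. n \<ge> N \<Longrightarrow> norm (f (Suc n)) \<le> 1 / 2 * norm (f n)"
    by (auto simp: eventually_sequentially)
  then have "summable f"
    by (intro summable_ratio_test[of "1 / 2" N]) auto
  then show "summable (\<lambda>n. fps_nth (fps_hypergeo [a] [c] t) n * w ^ n)" by (simp add: f_def)
qed

lemma kummer_1F1_sums:
  assumes "c \<notin> \<int>\<^sub>\<le>\<^sub>0"
  shows "(\<lambda>n. pochhammer a n / (pochhammer c n * fact n) * w ^ n) sums kummer_1F1 a c w"
  using sums_eval_fps[of w "fps_hypergeo [a] [c] 1"] assms
  by (simp add: fps_conv_radius_hypergeo_1_1 kummer_1F1_def)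

lemma pochhammer_neg_of_nat:
  assumes "i \<le> n"
  shows "pochhammer (- of_nat n :: complex) i = (- 1) ^ i * fact n / fact (n - i)"
proof -
  have "pochhammer (- of_nat n :: complex) i = (- 1) ^ i * fact i * (of_nat n gchoose i)"
    by (simp add: gbinomial_pochhammer flip: power_mult_distrib)
  also have "(of_nat n gchoose i :: complex) = fact n / (fact i * fact (n - i))"
    using assms by (simp add: binomial_gbinomial[symmetric] binomial_fact)
  finally show ?thesis by simp
qed

text \<open>Kummer's transformation on coefficients. Rewriting 1 / (n - i)! through the Pochhammer
  symbol of -n turns the Cauchy product into a terminating Gauss series at 1, which the
  Chu-Vandermonde identity evaluates.\<close>

lemma fps_exp_times_hypergeo_1_1:
  fixes a c :: complex
  assumes c: "c \<notin> \<int>\<^sub>\<le>\<^sub>0"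
  shows "fps_exp 1 * fps_hypergeo [a] [c] (- 1) = fps_hypergeo [c - a] [c] 1"
proof (rule fps_ext)
  fix n
  have c': "\<forall>i\<in>{0..<n}. c \<noteq> - of_nat i" using c by auto
  have "fps_nth (fps_exp 1 * fps_hypergeo [a] [c] (- 1)) n
      = (\<Sum>i=0..n. pochhammer a i * (- 1) ^ i / (pochhammer c i * fact i) * (1 / fact (n - i)))"
    by (subst mult.commute) (simp add: fps_mult_nth)
  also have "\<dots> = (\<Sum>i=0..n. pochhammer a i * pochhammer (- of_nat n) i / (of_nat (fact i) * pochhammer c i)) / fact n"
    by (auto simp: sum_divide_distrib pochhammer_neg_of_nat field_simps intro!: sum.cong)
  also have "\<dots> = pochhammer (c - a) n / pochhammer c n / fact n"
    by (subst Vandermonde_pochhammer[OF c']) simp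
  finally show "fps_nth (fps_exp 1 * fps_hypergeo [a] [c] (- 1)) n = fps_nth (fps_hypergeo [c - a] [c] 1) n"
    by simp
qed

lemma kummer_transformation:
  assumes c: "c \<notin> \<int>\<^sub>\<le>\<^sub>0"
  shows "exp w * kummer_1F1 a c (- w) = kummer_1F1 (c - a) c w"
proof -
  have "kummer_1F1 a c (- w) = eval_fps (fps_hypergeo [a] [c] (- 1)) w"
    unfolding kummer_1F1_def eval_fps_def
    by (intro suminf_cong) (simp add: power_minus[of w])
  then have "exp w * kummer_1F1 a c (- w) = eval_fps (fps_exp 1 * fps_hypergeo [a] [c] (- 1)) w"
    by (subst eval_fps_mult) (simp_all add: fps_conv_radius_hypergeo_1_1 c)
  then show ?thesis by (simp add: fps_exp_times_hypergeo_1_1 c kummer_1F1_def)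
qed

lemma three_halves_notin_nonpos_Ints: "3 / 2 \<notin> (\<int>\<^sub>\<le>\<^sub>0 :: complex set)"
  by (auto simp: complex_eq_iff elim!: nonpos_Ints_cases)

lemma pochhammer_half_three_halves:
  "pochhammer (1 / 2 :: complex) n * (2 * of_nat n + 1) = pochhammer (3 / 2) n"
proof -
  have "pochhammer (3 / 2 :: complex) n = 2 * pochhammer (1 / 2) (Suc n)"
    by (subst pochhammer_rec) simp
  then show ?thesis by (simp add: pochhammer_Suc algebra_simps)
qed

text \<open>The function w F(-w^2) is a primitive of exp(-w^2) vanishing at 0, where F is the Kummer
  series. This amounts to the differential equation F(x) + 2 x F'(x) = exp x, taken at x =
  -w^2.\<close>

lemma complex_erf_eq_kummer:
  "complex_erf w = 2 * w / complex_of_real (sqrt pi) * kummer_1F1 (1 / 2) (3 / 2) (- (w ^ 2))"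
proof -
  define F :: "complex fps" where "F = fps_hypergeo [1 / 2] [3 / 2] 1"
  have rad: "fps_conv_radius F = \<infinity>"
    by (simp add: F_def fps_conv_radius_hypergeo_1_1 three_halves_notin_nonpos_Ints)
  have rad': "fps_conv_radius (fps_deriv F) = \<infinity>"
    using fps_conv_radius_deriv[of F] rad by simp
  have nz: "pochhammer (3 / 2 :: complex) n \<noteq> 0" for n
    using three_halves_notin_nonpos_Ints pochhammer_eq_0_imp_nonpos_Int by blast
  \<comment> \<open>On coefficients the operator multiplies by 1 + 2 n, which is exactly the
    quotient of the Pochhammer symbols of 3/2 and 1/2.\<close>
  have "F + fps_const 2 * (fps_X * fps_deriv F) = fps_exp 1"
  proof (rule fps_ext)
    fix n
    have "fps_nth (F + fps_const 2 * (fps_X * fps_deriv F)) n = (1 + 2 * of_nat n) * fps_nth F n"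
      by (cases n) (simp_all add: algebra_simps)
    also have "\<dots> = 1 / fact n"
      using pochhammer_half_three_halves[of n] nz[of n] by (simp add: F_def field_simps)
    finally show "fps_nth (F + fps_const 2 * (fps_X * fps_deriv F)) n = fps_nth (fps_exp 1) n" by simp
  qed
  then have "eval_fps (F + fps_const 2 * (fps_X * fps_deriv F)) x = exp x" for x by simp
  moreover have "eval_fps (F + fps_const 2 * (fps_X * fps_deriv F)) x
      = eval_fps F x + 2 * (x * eval_fps (fps_deriv F) x)" for x
  proof -
    have 1: "fps_conv_radius (fps_X * fps_deriv F) = \<infinity>"
      using fps_conv_radius_mult[of fps_X "fps_deriv F"] rad' by simp
    have 2: "fps_conv_radius (fps_const 2 * (fps_X * fps_deriv F)) = \<infinity>"
      by (simp add: fps_conv_radius_cmult_left 1)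
    show ?thesis
      by (subst eval_fps_add, simp add: rad, simp add: 2)
         (subst eval_fps_mult, simp, simp add: 1, subst eval_fps_mult, simp, simp add: rad', simp)
  qed
  ultimately have ode: "eval_fps F x + 2 * (x * eval_fps (fps_deriv F) x) = exp x" for x by simp
  define G where "G = (\<lambda>w. w * eval_fps F (- (w ^ 2)))"
  have "(G has_field_derivative exp (- (w ^ 2))) (at w within A)" for w A
  proof -
    have "(eval_fps F has_field_derivative eval_fps (fps_deriv F) (- (w ^ 2))) (at (- (w ^ 2)))"
      by (rule has_field_derivative_eval_fps) (simp add: rad)
    moreover have "((\<lambda>w. - (w ^ 2)) has_field_derivative - (2 * w)) (at w within A)"
      by (auto intro!: derivative_eq_intros)
    ultimately have "((\<lambda>w. eval_fps F (- (w ^ 2))) has_field_derivative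
        eval_fps (fps_deriv F) (- (w ^ 2)) * (- (2 * w))) (at w within A)"
      by (rule DERIV_chain2)
    then have "(G has_field_derivative
        w * (eval_fps (fps_deriv F) (- (w ^ 2)) * (- (2 * w))) + 1 * eval_fps F (- (w ^ 2))) (at w within A)"
      unfolding G_def using DERIV_ident[of "at w within A"] DERIV_mult' by blast
    then show ?thesis
      unfolding ode[of "- (w ^ 2)", symmetric] by (simp add: power2_eq_square algebra_simps)
  qed
  then have "((\<lambda>t. exp (- (t ^ 2))) has_contour_integral (G (pathfinish (linepath 0 w)) - G (pathstart (linepath 0 w)))) (linepath 0 w)"
    by (intro contour_integral_primitive[where S = UNIV] valid_path_linepath subset_UNIV)
  then have "contour_integral (linepath 0 w) (\<lambda>t. exp (- (t ^ 2))) = G w"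
    by (simp add: contour_integral_unique G_def)
  then show ?thesis by (simp add: complex_erf_def G_def kummer_1F1_def F_def)
qed

text \<open>A form of the duplication formula. It converts the odd factorials of the sinh series
  into the parameter 3/2 of Kummer's series.\<close>

lemma fact_odd_eq_pochhammer:
  "fact (Suc (2 * i)) = (4 ^ i * pochhammer (3 / 2) i * fact i :: complex)"
proof (induction i)
  case (Suc i)
  have "fact (Suc (2 * Suc i)) = ((2 * of_nat i + 3) * (2 * of_nat i + 2) * fact (Suc (2 * i)) :: complex)"
    by (simp add: algebra_simps)
  also have "\<dots> = 4 ^ Suc i * pochhammer (3 / 2) (Suc i) * fact (Suc i)"
    unfolding Suc fact_Suc[of i] pochhammer_Suc power_Suc by (simp add: algebra_simps)
  finally show ?case .
qed simp

section \<open>The Gaussian integral of sinh over the half-line\<close>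

lemma sinh_odd_sums: "(\<lambda>i. w ^ (2 * i + 1) / fact (2 * i + 1)) sums sinh (w :: 'a :: {banach, real_normed_field})"
proof -
  have "(\<lambda>n. if even n then 0 else w ^ n /\<^sub>R fact n) sums sinh w" by (rule sinh_converges)
  then have "(\<lambda>i. if even (2 * i + 1) then 0 else w ^ (2 * i + 1) /\<^sub>R fact (2 * i + 1)) sums sinh w"
    by (subst sums_mono_reindex[where g = "\<lambda>i. 2 * i + 1"]) (auto simp: strict_mono_def elim!: oddE)
  then show ?thesis by (simp add: scaleR_conv_of_real field_simps)
qed

lemma summable_norm_sinh_odd:
  fixes w :: complex
  shows "summable (\<lambda>i. norm (w ^ (2 * i + 1) / fact (2 * i + 1)))"
  using sums_summable[OF sinh_odd_sums[of "norm w"]] 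
  by (simp add: norm_divide norm_mult norm_power del: fact_Suc)

text \<open>The function h of the overview. At u = \<open>sqrt \<alpha> * x\<close> it is the
  numerator of the integrand in \<open>K\<close>.\<close>

definition gauss_sinh :: "complex \<Rightarrow> real \<Rightarrow> complex" where
  "gauss_sinh z u = complex_of_real (exp (- (u ^ 2))) * sinh (complex_of_real u * z)"

text \<open>The sinh series is integrated termwise, the odd Gaussian moments being i! / 2. The
  resulting series is Kummer's with numerator parameter 1.\<close>

lemma gauss_sinh_integral:
  "has_bochner_integral lborel (\<lambda>u. indicator {0..} u *\<^sub>R gauss_sinh z u)
     (z / 2 * kummer_1F1 1 (3 / 2) (z ^ 2 / 4))"
proof -
  define g where "g = (\<lambda>i u. indicator {0..} u *\<^sub>R (exp (- (u ^ 2)) * u ^ (2 * i + 1)) :: real)"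
  define f where "f = (\<lambda>i u. complex_of_real (g i u) * (z ^ (2 * i + 1) / fact (2 * i + 1)))"
  have g: "has_bochner_integral lborel (g i) (fact i / 2)" for i
    unfolding g_def by (rule gaussian_moment_odd_pos)
  have g_nonneg: "g i u \<ge> 0" for i u by (auto simp: g_def indicator_def)
  have f: "has_bochner_integral lborel (f i) (complex_of_real (fact i / 2) * (z ^ (2 * i + 1) / fact (2 * i + 1)))" for i
    unfolding f_def by (intro has_bochner_integral_mult_left has_bochner_integral_of_real g)
  have coeff: "complex_of_real (fact i / 2) * (z ^ (2 * i + 1) / fact (2 * i + 1))
      = z / 2 * (pochhammer 1 i / (pochhammer (3 / 2) i * fact i) * (z ^ 2 / 4) ^ i)" for i
    by (simp add: fact_odd_eq_pochhammer pochhammer_fact[symmetric] power_mult power_divide del: fact_Suc)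
  have f_eq: "f i u = indicator {0..} u *\<^sub>R (complex_of_real (exp (- (u ^ 2)))
      * ((complex_of_real u * z) ^ (2 * i + 1) / fact (2 * i + 1)))" for i u
    by (simp add: f_def g_def scaleR_conv_of_real power_mult_distrib mult_ac)
  have f_sums: "(\<lambda>i. f i u) sums (indicator {0..} u *\<^sub>R gauss_sinh z u)" for u
    unfolding f_eq gauss_sinh_def by (intro sums_scaleR_right sums_mult sinh_odd_sums)
  have f_norm: "summable (\<lambda>i. norm (f i u))" for u
    unfolding f_eq norm_mult norm_scaleR by (intro summable_mult summable_norm_sinh_odd)
  have norm_f: "norm (f i u) = g i u * norm (z ^ (2 * i + 1) / fact (2 * i + 1))" for i u
    using g_nonneg[of i u] by (simp add: f_def norm_mult norm_divide)
  \<comment> \<open>Since \<open>g i\<close> is nonnegative, the integral of the norm is the norm of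
    the integral. Absolute convergence of Kummer's series then justifies the interchange.\<close>
  have int_norm: "(\<integral>u. norm (f i u) \<partial>lborel) = norm (z / 2) *
     norm (fps_nth (fps_hypergeo [1] [3 / 2] 1) i * (z ^ 2 / 4) ^ i)" for i
  proof -
    have "(\<integral>u. norm (f i u) \<partial>lborel) = fact i / 2 * norm (z ^ (2 * i + 1) / fact (2 * i + 1))"
      unfolding norm_f using has_bochner_integral_integral_eq[OF g[of i]] by simp
    also have "\<dots> = norm (complex_of_real (fact i / 2) * (z ^ (2 * i + 1) / fact (2 * i + 1)))"
      by (simp only: norm_mult norm_of_real) simp
    finally show ?thesis unfolding coeff norm_mult[of "z / 2"] by simp
  qed
  have sum_int: "summable (\<lambda>i. \<integral>u. norm (f i u) \<partial>lborel)"
    unfolding int_norm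
    by (intro summable_mult norm_summable_fps)
      (simp add: fps_conv_radius_hypergeo_1_1 three_halves_notin_nonpos_Ints)
  have int_f: "integrable lborel (f i)" for i using f by (rule integrable.intros)
  have "(\<integral>u. (\<Sum>i. f i u) \<partial>lborel) = (\<Sum>i. \<integral>u. f i u \<partial>lborel)"
    by (rule integral_suminf[OF int_f _ sum_int]) (simp add: f_norm)
  also have "(\<lambda>i. \<integral>u. f i u \<partial>lborel)
      = (\<lambda>i. z / 2 * (pochhammer 1 i / (pochhammer (3 / 2) i * fact i) * (z ^ 2 / 4) ^ i))"
    using has_bochner_integral_integral_eq[OF f] unfolding coeff by blast
  also have "(\<Sum>i. z / 2 * (pochhammer 1 i / (pochhammer (3 / 2) i * fact i) * (z ^ 2 / 4) ^ i))
      = z / 2 * kummer_1F1 1 (3 / 2) (z ^ 2 / 4)"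
    by (intro sums_unique[symmetric] sums_mult kummer_1F1_sums three_halves_notin_nonpos_Ints)
  finally have "(\<integral>u. (\<Sum>i. f i u) \<partial>lborel) = z / 2 * kummer_1F1 1 (3 / 2) (z ^ 2 / 4)" .
  moreover have "integrable lborel (\<lambda>u. \<Sum>i. f i u)"
    by (rule integrable_suminf[OF int_f _ sum_int]) (simp add: f_norm)
  moreover have "(\<Sum>i. f i u) = indicator {0..} u *\<^sub>R gauss_sinh z u" for u
    using f_sums by (rule sums_unique[symmetric])
  ultimately show ?thesis by (simp add: has_bochner_integral_iff)
qed

section \<open>Moments and Taylor remainders\<close>

lemma nn_integral_power_times_exp_scaled:
  assumes c: "c > 0"
  shows "(\<integral>\<^sup>+x. ennreal (x ^ k * exp (- (c * x))) * indicator {0..} x \<partial>lborel) = ennreal (fact k / c ^ Suc k)"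
proof -
  have "ennreal (fact k) = (\<integral>\<^sup>+x. ennreal (x ^ k * exp (- x)) * indicator {0..} x \<partial>lborel)"
    by (subst nn_intergal_power_times_exp_Ici) simp
  also have "\<dots> = ennreal \<bar>c\<bar> * (\<integral>\<^sup>+x. ennreal ((0 + c * x) ^ k * exp (- (0 + c * x))) * indicator {0..} (0 + c * x) \<partial>lborel)"
    using c by (intro nn_integral_real_affine) auto
  also have "(\<lambda>x. ennreal ((0 + c * x) ^ k * exp (- (0 + c * x))) * indicator {0..} (0 + c * x))
      = (\<lambda>x. ennreal (c ^ k) * (ennreal (x ^ k * exp (- (c * x))) * indicator {0..} x))"
  proof
    fix x
    show "ennreal ((0 + c * x) ^ k * exp (- (0 + c * x))) * indicator {0..} (0 + c * x)
      = ennreal (c ^ k) * (ennreal (x ^ k * exp (- (c * x))) * indicator {0..} x)"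
      using c by (cases "x \<ge> 0")
        (simp_all add: indicator_def zero_le_mult_iff power_mult_distrib mult.assoc ennreal_mult'[symmetric])
  qed
  also have "ennreal \<bar>c\<bar> * (\<integral>\<^sup>+x. ennreal (c ^ k) * (ennreal (x ^ k * exp (- (c * x))) * indicator {0..} x) \<partial>lborel)
      = ennreal (c ^ Suc k) * (\<integral>\<^sup>+x. ennreal (x ^ k * exp (- (c * x))) * indicator {0..} x \<partial>lborel)"
    using c by (subst nn_integral_cmult) (auto simp: ennreal_mult' mult.assoc)
  finally have "ennreal (1 / c ^ Suc k) * ennreal (fact k) = ennreal (1 / c ^ Suc k) * ennreal (c ^ Suc k)
      * (\<integral>\<^sup>+x. ennreal (x ^ k * exp (- (c * x))) * indicator {0..} x \<partial>lborel)"
    by (simp add: mult.assoc)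
  then show ?thesis using c by (simp flip: ennreal_mult' del: power_Suc)
qed

text \<open>The kernel is a geometric series in exp(-2 pi y), and each of its terms gives a Gamma
  integral. All terms are nonnegative, so monotone convergence yields integrability and value
  together.\<close>

lemma bose_integral:
  assumes p: "p > 0" and S: "(\<lambda>n. 1 / real (Suc n) ^ Suc p) sums S"
  shows "has_bochner_integral lborel (\<lambda>y. indicator {0..} y *\<^sub>R (y ^ p / (exp (2 * pi * y) - 1)) :: real)
           (fact p / (2 * pi) ^ Suc p * S)"
proof (rule has_bochner_integral_nn_integral)
  have nonneg: "indicator {0..} y *\<^sub>R (y ^ p / (exp (2 * pi * y) - 1)) \<ge> (0 :: real)" for y :: real
    by (auto simp: indicator_def)
  then show "AE y in lborel. indicator {0..} y *\<^sub>R (y ^ p / (exp (2 * pi * y) - 1)) \<ge> (0 :: real)" by simp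
  show "fact p / (2 * pi) ^ Suc p * S \<ge> 0"
    using sums_le[OF _ sums_zero S] by simp
  have geom: "(\<lambda>n. y ^ p * exp (- (2 * pi * real (Suc n) * y))) sums (y ^ p / (exp (2 * pi * y) - 1))"
    if "y \<ge> 0" for y :: real
  \<comment> \<open>At y = 0 the geometric series diverges, but the factor y ^ p is 0 because p > 0,
    and the quotient 0 / 0 is 0 by convention.\<close>
  proof (cases "y = 0")
    case True
    then show ?thesis using p by (simp add: power_0_left)
  next
    case False
    define q where "q = exp (- (2 * pi * y))"
    have q: "0 < q" "q < 1" using that False by (auto simp: q_def)
    have 1: "(\<lambda>n. y ^ p * (q * q ^ n)) sums (y ^ p * (q * (1 / (1 - q))))"
      using q by (intro sums_mult geometric_sums) simp
    have 2: "q * (1 / (1 - q)) = 1 / (exp (2 * pi * y) - 1)"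
      using q by (simp add: q_def exp_minus field_simps)
    have 3: "q * q ^ n = exp (- (2 * pi * real (Suc n) * y))" for n
    proof -
      have "q * q ^ n = exp (real (Suc n) * (- (2 * pi * y)))"
        unfolding q_def exp_of_nat_mult by (simp only: power_Suc)
      also have "real (Suc n) * (- (2 * pi * y)) = - (2 * pi * real (Suc n) * y)" by (simp only: mult_ac mult_minus_right)
      finally show ?thesis .
    qed
    show ?thesis using 1 unfolding 2 3 by simp
  qed
  have "(\<integral>\<^sup>+y. ennreal (indicator {0..} y *\<^sub>R (y ^ p / (exp (2 * pi * y) - 1))) \<partial>lborel)
      = (\<integral>\<^sup>+y. (\<Sum>n. ennreal (y ^ p * exp (- (2 * pi * real (Suc n) * y))) * indicator {0..} y) \<partial>lborel)"
  proof (rule nn_integral_cong)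
    fix y :: real
    show "ennreal (indicator {0..} y *\<^sub>R (y ^ p / (exp (2 * pi * y) - 1)))
      = (\<Sum>n. ennreal (y ^ p * exp (- (2 * pi * real (Suc n) * y))) * indicator {0..} y)"
    proof (cases "y \<ge> 0")
      case True
      have "(\<Sum>n. ennreal (y ^ p * exp (- (2 * pi * real (Suc n) * y)))) = ennreal (y ^ p / (exp (2 * pi * y) - 1))"
        by (rule suminf_ennreal_eq[OF _ geom[OF True]]) (use True in simp)
      then show ?thesis using True by (simp del: of_nat_Suc)
    qed simp
  qed
  also have "\<dots> = (\<Sum>n. \<integral>\<^sup>+y. ennreal (y ^ p * exp (- (2 * pi * real (Suc n) * y))) * indicator {0..} y \<partial>lborel)"
    by (intro nn_integral_suminf) auto
  also have "\<dots> = (\<Sum>n. ennreal (fact p / (2 * pi * real (Suc n)) ^ Suc p))"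
    by (intro suminf_cong nn_integral_power_times_exp_scaled) simp
  also have "\<dots> = (\<Sum>n. ennreal (fact p / (2 * pi) ^ Suc p * (1 / real (Suc n) ^ Suc p)))"
    by (simp add: power_mult_distrib del: power_Suc)
  also have "\<dots> = ennreal (fact p / (2 * pi) ^ Suc p * S)"
    by (intro suminf_ennreal_eq sums_mult S) simp
  finally show "(\<integral>\<^sup>+y. ennreal (indicator {0..} y *\<^sub>R (y ^ p / (exp (2 * pi * y) - 1))) \<partial>lborel)
    = ennreal (fact p / (2 * pi) ^ Suc p * S)" .
qed measurable

section \<open>Taylor expansion with a global remainder bound\<close>

text \<open>The coefficient of u ^ (2 k + 1) in \<open>gauss_sinh z u\<close>, written as a Cauchy
  product. It equals H(z / 2) / (2 k + 1)!, where H is the physicists' Hermite polynomial of degree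
  2 k + 1.\<close>

definition gauss_sinh_coeff :: "complex \<Rightarrow> nat \<Rightarrow> complex" where
  "gauss_sinh_coeff z k = (\<Sum>i\<le>k. z ^ (2 * i + 1) / fact (2 * i + 1) * ((- 1) ^ (k - i) / fact (k - i)))"

lemma summable_gauss_sinh_coeff: "summable (\<lambda>k. norm (gauss_sinh_coeff z k))"
proof (rule summable_comparison_test')
  show "summable (\<lambda>k. \<Sum>i\<le>k. norm (z ^ (2 * i + 1) / fact (2 * i + 1)) * norm ((- 1) ^ (k - i) / fact (k - i) :: complex))"
  proof (rule summable_Cauchy_product)
    show "summable (\<lambda>k. norm (norm (z ^ (2 * k + 1) / fact (2 * k + 1))))"
      using summable_norm_sinh_odd[of z] by simp
    show "summable (\<lambda>k. norm (norm ((- 1) ^ k / fact k :: complex)))"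
      using summable_norm_exp[of "1 :: complex"] by (simp add: norm_divide norm_power divide_inverse norm_mult norm_inverse)
  qed
  show "norm (norm (gauss_sinh_coeff z k))
     \<le> (\<Sum>i\<le>k. norm (z ^ (2 * i + 1) / fact (2 * i + 1)) * norm ((- 1) ^ (k - i) / fact (k - i) :: complex))" for k
    unfolding gauss_sinh_coeff_def real_norm_def abs_norm_cancel norm_mult[symmetric] by (rule norm_sum)
qed

lemma gauss_sinh_sums: "(\<lambda>k. gauss_sinh_coeff z k * of_real u ^ (2 * k + 1)) sums gauss_sinh z u"
proof -
  define w :: complex where "w = of_real u"
  define a where "a = (\<lambda>i. (w * z) ^ (2 * i + 1) / fact (2 * i + 1))"
  define b where "b = (\<lambda>j. (- (w ^ 2)) ^ j /\<^sub>R fact j)"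
  have "(\<lambda>k. \<Sum>i\<le>k. a i * b (k - i)) sums ((\<Sum>i. a i) * (\<Sum>j. b j))"
    unfolding a_def b_def by (intro Cauchy_product_sums summable_norm_sinh_odd summable_norm_exp)
  also have "(\<Sum>i. a i) = sinh (w * z)"
    unfolding a_def by (rule sums_unique[OF sinh_odd_sums, symmetric])
  also have "(\<Sum>j. b j) = exp (- (w ^ 2))"
    unfolding b_def exp_def ..
  also have "(\<lambda>k. \<Sum>i\<le>k. a i * b (k - i)) = (\<lambda>k. gauss_sinh_coeff z k * w ^ (2 * k + 1))"
  proof
    fix k
    have "a i * b (k - i) = z ^ (2 * i + 1) / fact (2 * i + 1) * ((- 1) ^ (k - i) / fact (k - i)) * w ^ (2 * k + 1)"
      if "i \<le> k" for i
    proof -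
      have e: "2 * k + 1 = (2 * i + 1) + 2 * (k - i)" using that by simp
      have "w ^ (2 * k + 1) = w ^ (2 * i + 1) * (w ^ 2) ^ (k - i)"
        unfolding e power_add power_mult ..
      then show ?thesis
        by (simp only: a_def b_def power_mult_distrib power_minus[of "w ^ 2"] scaleR_conv_of_real)
          (simp add: field_simps del: fact_Suc)
    qed
    then show "(\<Sum>i\<le>k. a i * b (k - i)) = gauss_sinh_coeff z k * w ^ (2 * k + 1)"
      by (simp add: gauss_sinh_coeff_def sum_distrib_right del: fact_Suc)
  qed
  also have "sinh (w * z) * exp (- (w ^ 2)) = gauss_sinh z u"
    by (simp add: gauss_sinh_def w_def exp_of_real[symmetric])
  finally show ?thesis by (simp add: w_def)
qed

lemma norm_sinh_le_exp: "norm (sinh w) \<le> exp (norm w)" for w :: complex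
proof -
  have "norm (sinh w) \<le> (norm (exp w) + norm (exp (- w))) / 2"
    unfolding sinh_field_def using norm_triangle_ineq4[of "exp w" "exp (- w)"]
    by (simp only: norm_divide) simp
  also have "\<dots> \<le> exp (norm w)"
    using add_mono[OF norm_exp[of w] norm_exp[of "- w"]] by (simp del: norm_exp_eq_Re)
  finally show ?thesis .
qed

text \<open>Completing the square in the exponent -u^2 + |u| |z|.\<close>

lemma gauss_sinh_bound: "norm (gauss_sinh z u) \<le> exp (norm z ^ 2 / 4)"
proof -
  have "norm (gauss_sinh z u) \<le> exp (- (u ^ 2)) * exp (\<bar>u\<bar> * norm z)"
    unfolding gauss_sinh_def norm_mult using norm_sinh_le_exp[of "of_real u * z"]
    by (intro mult_mono) (auto simp: norm_mult)
  also have "\<dots> = exp (norm z ^ 2 / 4 - (\<bar>u\<bar> - norm z / 2) ^ 2)"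
    by (simp add: exp_add[symmetric] power2_eq_square algebra_simps)
  also have "\<dots> \<le> exp (norm z ^ 2 / 4)" by simp
  finally show ?thesis .
qed

text \<open>For u \<le> 1 the remainder is the tail of an absolutely summable series and each power
  in it is at most u ^ (2 N + 1). For u > 1 the function is bounded and all lower powers are at most
  u ^ (2 N + 1). One constant serves both ranges, so the estimate can be integrated without
  splitting the domain.\<close>

lemma gauss_sinh_remainder:
  obtains C where
    "\<And>u. u \<ge> 0 \<Longrightarrow> norm (gauss_sinh z u - (\<Sum>k<N. gauss_sinh_coeff z k * of_real u ^ (2 * k + 1)))
        \<le> C * u ^ (2 * N + 1)"
proof
  define c where "c = gauss_sinh_coeff z"
  define A where "A = (\<Sum>k. norm (c k))"
  have c: "summable (\<lambda>k. norm (c k))" unfolding c_def by (rule summable_gauss_sinh_coeff)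
  fix u :: real assume u: "u \<ge> 0"
  show "norm (gauss_sinh z u - (\<Sum>k<N. gauss_sinh_coeff z k * of_real u ^ (2 * k + 1)))
        \<le> (exp (norm z ^ 2 / 4) + A) * u ^ (2 * N + 1)"
  proof (cases "u \<le> 1")
    case True
    define f where "f = (\<lambda>k. c k * of_real u ^ (2 * k + 1))"
    have bound: "norm (f (k + N)) \<le> norm (c (k + N)) * u ^ (2 * N + 1)" for k
      using True unfolding f_def norm_mult norm_power norm_of_real abs_of_nonneg[OF u]
      by (intro mult_left_mono power_decreasing u) auto
    have sc: "summable (\<lambda>k. norm (c (k + N)) * u ^ (2 * N + 1))"
      using c summable_iff_shift[of "\<lambda>k. norm (c k)" N] by (intro summable_mult2) simp
    have "(\<lambda>k. f (k + N)) sums (gauss_sinh z u - (\<Sum>k<N. f k))"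
      using gauss_sinh_sums[of z u] unfolding f_def c_def by (rule sums_split_initial_segment)
    then have "norm (gauss_sinh z u - (\<Sum>k<N. f k)) = norm (\<Sum>k. f (k + N))"
      by (simp add: sums_iff)
    also have "\<dots> \<le> (\<Sum>k. norm (c (k + N)) * u ^ (2 * N + 1))"
      by (rule norm_suminf_le[OF bound sc])
    also have "\<dots> = (\<Sum>k. norm (c (k + N))) * u ^ (2 * N + 1)"
      using c summable_iff_shift[of "\<lambda>k. norm (c k)" N] by (intro suminf_mult2[symmetric]) simp
    also have "(\<Sum>k. norm (c (k + N))) \<le> A"
      unfolding A_def suminf_split_initial_segment[OF c, of N] by (simp add: sum_nonneg)
    also have "A \<le> exp (norm z ^ 2 / 4) + A" by simp
    finally show ?thesis using u by (simp add: f_def c_def mult_right_mono)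
  next
    case False
    have "norm (gauss_sinh z u - (\<Sum>k<N. c k * of_real u ^ (2 * k + 1)))
        \<le> norm (gauss_sinh z u) + (\<Sum>k<N. norm (c k * of_real u ^ (2 * k + 1)))"
      by (intro order_trans[OF norm_triangle_ineq4] add_left_mono norm_sum)
    also have "\<dots> \<le> exp (norm z ^ 2 / 4) * u ^ (2 * N + 1) + (\<Sum>k<N. norm (c k) * u ^ (2 * N + 1))"
    proof (intro add_mono sum_mono)
      have "1 \<le> u ^ (2 * N + 1)" using False by (intro one_le_power) simp
      then show "norm (gauss_sinh z u) \<le> exp (norm z ^ 2 / 4) * u ^ (2 * N + 1)"
        using gauss_sinh_bound[of z u] by (metis exp_ge_zero mult_left_mono mult.right_neutral order_trans)
      fix k assume "k \<in> {..<N}"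
      then show "norm (c k * of_real u ^ (2 * k + 1)) \<le> norm (c k) * u ^ (2 * N + 1)"
        using False unfolding norm_mult norm_power norm_of_real abs_of_nonneg[OF u]
        by (intro mult_left_mono power_increasing) auto
    qed
    also have "\<dots> = (exp (norm z ^ 2 / 4) + (\<Sum>k<N. norm (c k))) * u ^ (2 * N + 1)"
      by (simp only: sum_distrib_right[symmetric] distrib_right)
    also have "\<dots> \<le> (exp (norm z ^ 2 / 4) + A) * u ^ (2 * N + 1)"
      unfolding A_def using u c by (intro mult_right_mono add_left_mono sum_le_suminf) auto
    finally show ?thesis by (simp add: c_def)
  qed
qed

section \<open>Planck integrals and their termwise expansion\<close>

definition planck_moment :: "nat \<Rightarrow> real" where
  "planck_moment k = (LINT y|lborel. indicator {0..} y *\<^sub>R (y ^ (2 * k + 1) / (exp (2 * pi * y) - 1)))"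

text \<open>The Bose integral with exponent 2 k + 1 produces \<zeta>(2 k + 2). Hence the Taylor term
  of index k supplies the term m = k + 1 of the final expansion.\<close>

lemma planck_moment_eq_zeta:
  shows integrable_planck_moment:
      "integrable lborel (\<lambda>y. indicator {0..} y *\<^sub>R (y ^ (2 * k + 1) / (exp (2 * pi * y) - 1)) :: real)"
    and planck_moment: "complex_of_real (planck_moment k)
      = fact (2 * k + 1) / of_real ((2 * pi) ^ (2 * Suc k)) * riemann_zeta (of_nat (2 * Suc k))"
proof -
  define Z where "Z = riemann_zeta (of_nat (2 * Suc k))"
  have 1: "(\<lambda>n. complex_of_real (1 / real (Suc n) ^ (2 * Suc k))) sums Z"
    unfolding Z_def by (rule riemann_zeta_even_sums) simp
  have 2: "(\<lambda>n. 1 / real (Suc n) ^ (2 * Suc k)) sums Re Z"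
    using sums_Re[OF 1] by (simp only: Re_complex_of_real)
  \<comment> \<open>The zeta value is real as a sum of real terms; this carries the real integral
    over to the complex statement.\<close>
  have Z: "complex_of_real (Re Z) = Z"
    using sums_unique2[OF sums_of_real[OF 2] 1] .
  have e: "2 * Suc k = Suc (2 * k + 1)" by simp
  have B: "has_bochner_integral lborel (\<lambda>y. indicator {0..} y *\<^sub>R (y ^ (2 * k + 1) / (exp (2 * pi * y) - 1)) :: real)
           (fact (2 * k + 1) / (2 * pi) ^ (2 * Suc k) * Re Z)"
    using 2 unfolding e by (intro bose_integral) simp_all
  show "integrable lborel (\<lambda>y. indicator {0..} y *\<^sub>R (y ^ (2 * k + 1) / (exp (2 * pi * y) - 1)) :: real)"
    using B by (rule integrable.intros)
  have "planck_moment k = fact (2 * k + 1) / (2 * pi) ^ (2 * Suc k) * Re Z"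
    unfolding planck_moment_def using B by (rule has_bochner_integral_integral_eq)
  then have "complex_of_real (planck_moment k)
      = fact (2 * k + 1) / of_real ((2 * pi) ^ (2 * Suc k)) * complex_of_real (Re Z)"
    by (simp only: of_real_mult of_real_divide of_real_fact)
  then show "complex_of_real (planck_moment k)
      = fact (2 * k + 1) / of_real ((2 * pi) ^ (2 * Suc k)) * riemann_zeta (of_nat (2 * Suc k))"
    unfolding Z by (simp only: Z_def)
qed

definition planck_transform :: "complex \<Rightarrow> real \<Rightarrow> complex" where
  "planck_transform z s =
     (LINT y|lborel. indicator {0..} y *\<^sub>R (gauss_sinh z (s * y) / of_real (exp (2 * pi * y) - 1)))"

lemma borel_measurable_gauss_sinh [measurable]: "gauss_sinh z \<in> borel_measurable borel"
  unfolding gauss_sinh_def[abs_def]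
  by (intro borel_measurable_continuous_onI continuous_intros)

text \<open>The remainder bound with no Taylor terms gives |h u| \<le> C u, which compensates the
  simple pole of the kernel at 0. The moment of index 0 is then an integrable majorant.\<close>

lemma integrable_planck_transform:
  assumes s: "s > 0"
  shows "integrable lborel (\<lambda>y. indicator {0..} y *\<^sub>R (gauss_sinh z (s * y) / of_real (exp (2 * pi * y) - 1)))"
proof -
  obtain C where C: "\<And>u. u \<ge> 0 \<Longrightarrow> norm (gauss_sinh z u) \<le> C * u"
    using gauss_sinh_remainder[of z 0] by auto
  show ?thesis
  proof (rule Bochner_Integration.integrable_bound)
    show "integrable lborel (\<lambda>y. (C * s) * (indicator {0..} y *\<^sub>R (y ^ (2 * 0 + 1) / (exp (2 * pi * y) - 1))) :: real)"
      by (intro integrable_mult_right integrable_planck_moment)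
    show "AE y in lborel. norm (indicator {0..} y *\<^sub>R (gauss_sinh z (s * y) / of_real (exp (2 * pi * y) - 1)))
       \<le> norm ((C * s) * (indicator {0..} y *\<^sub>R (y ^ (2 * 0 + 1) / (exp (2 * pi * y) - 1))) :: real)"
    proof (intro AE_I2)
      fix y :: real
      show "norm (indicator {0..} y *\<^sub>R (gauss_sinh z (s * y) / of_real (exp (2 * pi * y) - 1)))
       \<le> norm ((C * s) * (indicator {0..} y *\<^sub>R (y ^ (2 * 0 + 1) / (exp (2 * pi * y) - 1))) :: real)"
      proof (cases "y \<ge> 0")
        case True
        have "norm (gauss_sinh z (s * y)) \<le> \<bar>C * s * y\<bar>"
          using C[of "s * y"] s True by (simp add: mult.assoc)
        then have "norm (gauss_sinh z (s * y)) / \<bar>exp (2 * pi * y) - 1\<bar> \<le> \<bar>C * s * y\<bar> / \<bar>exp (2 * pi * y) - 1\<bar>"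
          by (intro divide_right_mono) auto
        then show ?thesis using True
          by (simp add: norm_divide abs_mult mult.assoc del: of_real_diff)
      qed simp
    qed
  qed measurable
qed

text \<open>The global remainder bound at u = s y is integrated against the Planck kernel. The
  resulting constant is \<open>C * planck_moment N\<close>.\<close>

lemma planck_transform_expansion:
  obtains C where "\<And>s. s > 0 \<Longrightarrow>
    norm (planck_transform z s
        - (\<Sum>k<N. gauss_sinh_coeff z k * of_real s ^ (2 * k + 1) * of_real (planck_moment k)))
      \<le> C * s ^ (2 * N + 1)"
proof -
  obtain C where C:
    "\<And>u. u \<ge> 0 \<Longrightarrow> norm (gauss_sinh z u - (\<Sum>k<N. gauss_sinh_coeff z k * of_real u ^ (2 * k + 1)))
        \<le> C * u ^ (2 * N + 1)"
    using gauss_sinh_remainder[of z N] by blast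
  define p where "p = (\<lambda>k y. indicator {0..} y *\<^sub>R (y ^ (2 * k + 1) / (exp (2 * pi * y) - 1)) :: real)"
  have p: "integrable lborel (p k)" for k unfolding p_def by (rule integrable_planck_moment)
  have pm: "planck_moment k = (LINT y|lborel. p k y)" for k
    unfolding planck_moment_def p_def ..
  show thesis
  proof (rule that)
    fix s :: real assume s: "s > 0"
    define g where "g = (\<lambda>y. indicator {0..} y *\<^sub>R (gauss_sinh z (s * y) / of_real (exp (2 * pi * y) - 1)))"
    define d where "d = (\<lambda>k. gauss_sinh_coeff z k * of_real s ^ (2 * k + 1))"
    have g: "integrable lborel g" unfolding g_def by (rule integrable_planck_transform[OF s])
    have pt: "planck_transform z s = (LINT y|lborel. g y)"
      unfolding planck_transform_def g_def ..
    have q: "integrable lborel (\<lambda>y. \<Sum>k<N. d k * of_real (p k y))"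
      using p by (intro Bochner_Integration.integrable_sum integrable_mult_right integrable_of_real)
    have "(LINT y|lborel. g y - (\<Sum>k<N. d k * of_real (p k y)))
       = planck_transform z s - (\<Sum>k<N. d k * of_real (planck_moment k))"
      using g q p by (simp add: pt pm)
    moreover have "norm (LINT y|lborel. g y - (\<Sum>k<N. d k * of_real (p k y)))
        \<le> (LINT y|lborel. (C * s ^ (2 * N + 1)) * p N y)"
    proof (rule Bochner_Integration.integral_norm_bound_integral)
      show "integrable lborel (\<lambda>y. g y - (\<Sum>k<N. d k * of_real (p k y)))"
        using g q by (rule Bochner_Integration.integrable_diff)
      show "integrable lborel (\<lambda>y. (C * s ^ (2 * N + 1)) * p N y)"
        using p by (rule integrable_mult_right)
      fix y :: real
      show "norm (g y - (\<Sum>k<N. d k * of_real (p k y))) \<le> (C * s ^ (2 * N + 1)) * p N y"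
      proof (cases "y \<ge> 0")
        case True
        define D where "D = exp (2 * pi * y) - 1"
        have D: "D \<ge> 0" using True by (simp add: D_def)
        have "g y - (\<Sum>k<N. d k * of_real (p k y))
           = (gauss_sinh z (s * y) - (\<Sum>k<N. gauss_sinh_coeff z k * of_real (s * y) ^ (2 * k + 1))) / of_real D"
          using True by (simp add: g_def p_def d_def D_def diff_divide_distrib
              sum_divide_distrib power_mult_distrib mult_ac)
        then have "norm (g y - (\<Sum>k<N. d k * of_real (p k y)))
           = norm (gauss_sinh z (s * y) - (\<Sum>k<N. gauss_sinh_coeff z k * of_real (s * y) ^ (2 * k + 1))) / D"
          using D by (simp only: norm_divide norm_of_real abs_of_nonneg)
        also have "\<dots> \<le> C * (s * y) ^ (2 * N + 1) / D"
          using True s D by (intro divide_right_mono C) auto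
        also have "\<dots> = (C * s ^ (2 * N + 1)) * p N y"
          using True by (simp add: p_def D_def power_mult_distrib mult_ac)
        finally show ?thesis .
      qed (simp add: g_def p_def)
    qed
    ultimately show "norm (planck_transform z s
        - (\<Sum>k<N. gauss_sinh_coeff z k * of_real s ^ (2 * k + 1) * of_real (planck_moment k)))
      \<le> (C * planck_moment N) * s ^ (2 * N + 1)"
      by (simp add: d_def pm mult_ac)
  qed
qed

section \<open>Matching the coefficients\<close>

text \<open>The series terminates at i = k, and its terms match those of the Cauchy product one by
  one.\<close>

lemma kummer_three_halves_neg_nat:
  "z * kummer_1F1 (- of_nat k) (3 / 2) (z ^ 2 / 4) = (- 1) ^ k * fact k * gauss_sinh_coeff z k"
proof -
  have "(\<lambda>i. pochhammer (- of_nat k) i / (pochhammer (3 / 2) i * fact i) * (z ^ 2 / 4) ^ i)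
      sums (\<Sum>i\<le>k. pochhammer (- of_nat k) i / (pochhammer (3 / 2) i * fact i) * (z ^ 2 / 4) ^ i)"
    by (rule sums_finite) (auto simp: pochhammer_of_nat_eq_0_iff)
  from sums_unique2[OF kummer_1F1_sums[OF three_halves_notin_nonpos_Ints] this]
  have "z * kummer_1F1 (- of_nat k) (3 / 2) (z ^ 2 / 4)
     = (\<Sum>i\<le>k. z * (pochhammer (- of_nat k) i / (pochhammer (3 / 2) i * fact i) * (z ^ 2 / 4) ^ i))"
    by (simp add: sum_distrib_left)
  also have "\<dots> = (\<Sum>i\<le>k. (- 1) ^ k * fact k * (z ^ (2 * i + 1) / fact (2 * i + 1) * ((- 1) ^ (k - i) / fact (k - i))))"
  proof (intro sum.cong refl)
    fix i assume "i \<in> {..k}"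
    then have i: "i \<le> k" by simp
    \<comment> \<open>The exponent has the parity of i.\<close>
    have "k + (k - i) = 2 * (k - i) + i" using i by simp
    then have sgn: "(- 1) ^ k * (- 1) ^ (k - i) = ((- 1) ^ i :: complex)"
      by (simp only: power_add[symmetric]) (simp add: power_add power_mult)
    have odd: "fact (2 * i + 1) = (4 ^ i * pochhammer (3 / 2) i * fact i :: complex)"
      using fact_odd_eq_pochhammer[of i] by (simp del: fact_Suc)
    have z_pow: "z ^ (2 * i + 1) = z * (z ^ 2) ^ i" by (simp add: power_mult)
    have "(- 1) ^ k * fact k * (z ^ (2 * i + 1) / fact (2 * i + 1) * ((- 1) ^ (k - i) / fact (k - i)))
        = ((- 1) ^ k * (- 1) ^ (k - i)) * fact k / fact (k - i) * (z ^ (2 * i + 1) / fact (2 * i + 1))"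
      by (simp only: times_divide_eq_right times_divide_eq_left divide_divide_eq_left mult_ac)
    also have "\<dots> = z * (pochhammer (- of_nat k) i / (pochhammer (3 / 2) i * fact i) * (z ^ 2 / 4) ^ i)"
      unfolding sgn pochhammer_neg_of_nat[OF i] odd z_pow by (simp add: power_divide mult_ac)
    finally show "z * (pochhammer (- of_nat k) i / (pochhammer (3 / 2) i * fact i) * (z ^ 2 / 4) ^ i)
       = (- 1) ^ k * fact k * (z ^ (2 * i + 1) / fact (2 * i + 1) * ((- 1) ^ (k - i) / fact (k - i)))" ..
  qed
  finally show ?thesis by (simp only: gauss_sinh_coeff_def sum_distrib_left)
qed

lemma Gamma_nat_plus_half:
  "Gamma (of_nat (Suc k) + 1 / 2 :: complex) = of_real (sqrt pi) * fact (2 * k + 1) / (2 * 4 ^ k * fact k)"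
proof -
  have half: "1 / 2 \<notin> (\<int>\<^sub>\<le>\<^sub>0 :: complex set)"
    by (auto simp: complex_eq_iff elim!: nonpos_Ints_cases)
  have "pochhammer (1 / 2 :: complex) (Suc k) = Gamma (1 / 2 + of_nat (Suc k)) / Gamma (1 / 2)"
    by (rule pochhammer_Gamma[OF half])
  then have "Gamma (of_nat (Suc k) + 1 / 2 :: complex) = of_real (sqrt pi) * pochhammer (1 / 2) (Suc k)"
    by (simp add: Gamma_one_half_complex add.commute)
  also have "pochhammer (1 / 2 :: complex) (Suc k) = pochhammer (3 / 2) k / 2"
    by (subst pochhammer_rec) simp
  also have "of_real (sqrt pi) * (pochhammer (3 / 2) k / 2)
      = of_real (sqrt pi) * fact (2 * k + 1) / (2 * 4 ^ k * fact k :: complex)"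
    using fact_odd_eq_pochhammer[of k] by (simp del: fact_Suc)
  finally show ?thesis .
qed

text \<open>For a = k + 3/2 the transformed parameter 3/2 - a is -k, so the series becomes the
  terminating one. Its factor k! cancels against the denominator of the Gamma value, and the
  exponential comes from z^2 / 8 = -z^2 / 8 + z^2 / 4.\<close>

lemma coefficient_match:
  assumes z: "z \<noteq> 0"
  shows "2 / complex_of_real (sqrt pi) * exp (z ^ 2 / 8)
     * (Gamma (of_nat (Suc k) + 1 / 2) * kummer_1F1 (of_nat (Suc k) + 1 / 2) (3 / 2) (- (z ^ 2) / 4))
   = (- 1) ^ k * (exp (- (z ^ 2) / 8) * fact (2 * k + 1) / 4 ^ k * gauss_sinh_coeff z k / z)"
proof -
  define a :: complex where "a = of_nat (Suc k) + 1 / 2"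
  have "3 / 2 - a = - of_nat k" by (simp add: a_def)
  then have "exp (z ^ 2 / 4) * kummer_1F1 a (3 / 2) (- (z ^ 2) / 4) = kummer_1F1 (- of_nat k) (3 / 2) (z ^ 2 / 4)"
    using kummer_transformation[OF three_halves_notin_nonpos_Ints, of "z ^ 2 / 4" a] by simp
  also have "\<dots> = (- 1) ^ k * fact k * gauss_sinh_coeff z k / z"
    using kummer_three_halves_neg_nat[of z k] z by (simp add: field_simps)
  finally have kum: "exp (z ^ 2 / 4) * kummer_1F1 a (3 / 2) (- (z ^ 2) / 4)
     = (- 1) ^ k * fact k * gauss_sinh_coeff z k / z" .
  have ex: "exp (z ^ 2 / 8) = exp (- (z ^ 2) / 8) * exp (z ^ 2 / 4)"
    by (simp flip: exp_add)
  have pi: "complex_of_real (sqrt pi) \<noteq> 0" by simp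
  have "2 / complex_of_real (sqrt pi) * exp (z ^ 2 / 8) * (Gamma a * kummer_1F1 a (3 / 2) (- (z ^ 2) / 4))
     = 2 / complex_of_real (sqrt pi) * exp (- (z ^ 2) / 8) * Gamma a
        * (exp (z ^ 2 / 4) * kummer_1F1 a (3 / 2) (- (z ^ 2) / 4))"
    unfolding ex by (simp only: mult_ac)
  also have "\<dots> = (- 1) ^ k * (exp (- (z ^ 2) / 8) * fact (2 * k + 1) / 4 ^ k * gauss_sinh_coeff z k / z)"
    unfolding kum unfolding a_def Gamma_nat_plus_half using pi by (simp add: field_simps del: fact_Suc)
  finally show ?thesis by (simp only: a_def)
qed

section \<open>Decomposition of \<open>K\<close> and comparison with the scale\<close>

text \<open>Let X be the contribution of the error function. After reflection the Gaussian part of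
  the integral contributes -2 X, which leaves -X, the future term m = 0. The rest is the Planck
  integral.\<close>

lemma K_eq:
  assumes z: "z \<noteq> 0" and \<alpha>: "\<alpha> > 0"
  shows "K z \<alpha> = - (of_real (\<alpha> powr (- 1 / 4)) * exp (z ^ 2 / 8) * kummer_1F1 (1 / 2) (3 / 2) (- (z ^ 2) / 4))
     - 4 / z * of_real (\<alpha> powr (1 / 4)) * exp (- (z ^ 2) / 8) * planck_transform z (sqrt \<alpha>)"
proof -
  define s where "s = sqrt \<alpha>"
  define F where "F = kummer_1F1 (1 / 2) (3 / 2) (- (z ^ 2) / 4)"
  have s: "s > 0" "s ^ 2 = \<alpha>" using \<alpha> by (simp_all add: s_def)
  define g where "g = (\<lambda>u. indicator {0..} u *\<^sub>R gauss_sinh z u)"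
  define h where "h = (\<lambda>y. indicator {0..} y *\<^sub>R (gauss_sinh z (s * y) / of_real (exp (2 * pi * y) - 1)))"
  define f where "f = (\<lambda>x. indicator {..0} x *\<^sub>R (complex_of_real (exp (- \<alpha> * x ^ 2))
       * sinh (complex_of_real (sqrt \<alpha> * x) * z) / complex_of_real (exp (2 * pi * x) - 1)))"
  have g: "has_bochner_integral lborel g (z / 2 * kummer_1F1 1 (3 / 2) (z ^ 2 / 4))"
    unfolding g_def by (rule gauss_sinh_integral)
  have ig: "integrable lborel (\<lambda>y. g (s * y))"
    using lborel_integrable_real_affine_iff[of s g 0] s g by (auto simp: integrable.simps)
  have ih: "integrable lborel h" unfolding h_def by (rule integrable_planck_transform[OF s(1)])
  \<comment> \<open>Oddness of sinh supplies the sign in -1 / (1 / E - 1) = 1 + 1 / (E - 1). At y =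
    0 the factor sinh 0 makes all three functions vanish; for y < 0 the indicators do.\<close>
  have "f (0 + (- 1) * y) = g (s * y) + h y" for y
  proof (cases "y > 0")
    case True
    define E where "E = exp (2 * pi * y)"
    have E: "E > 1" using True by (simp add: E_def)
    then have E': "complex_of_real E \<noteq> 1" "complex_of_real E \<noteq> 0" by auto
    have 1: "exp (2 * pi * (- y)) = 1 / E" by (simp add: E_def exp_minus field_simps)
    have 2: "- \<alpha> * (- y) ^ 2 = - ((s * y) ^ 2)" by (simp add: power_mult_distrib s(2))
    have 3: "sinh (complex_of_real (sqrt \<alpha> * (- y)) * z) = - sinh (complex_of_real (s * y) * z)"
      by (simp add: s_def)
    have "f (0 + (- 1) * y) = gauss_sinh z (s * y) * (- 1 / (1 / complex_of_real E - 1))"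
      using True unfolding f_def
      by (simp add: 1[simplified] 2[simplified] gauss_sinh_def s_def[symmetric])
    also have "- 1 / (1 / complex_of_real E - 1) = 1 + 1 / (complex_of_real E - 1)"
      using E' by (simp add: field_simps)
    finally show ?thesis using True s
      by (simp add: g_def h_def E_def distrib_left)
  next
    case False
    then consider "y = 0" | "y < 0" by linarith
    then show ?thesis
    proof cases
      case 2
      then have "s * y < 0" using s by (simp add: mult_pos_neg)
      with 2 show ?thesis by (simp add: f_def g_def h_def)
    qed (simp add: f_def g_def h_def gauss_sinh_def)
  qed
  then have "(LINT x|lborel. f x) = (LINT y|lborel. g (s * y) + h y)"
    using lborel_integral_real_affine[of "- 1" f 0] by simp
  also have "\<dots> = (LINT y|lborel. g (s * y)) + planck_transform z s"
    using ig ih by (simp add: planck_transform_def h_def)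
  also have "(LINT y|lborel. g (s * y)) = z / 2 * kummer_1F1 1 (3 / 2) (z ^ 2 / 4) / of_real s"
    using lborel_integral_real_affine[of s g 0] s has_bochner_integral_integral_eq[OF g]
    by (simp add: scaleR_conv_of_real field_simps)
  also have "kummer_1F1 1 (3 / 2) (z ^ 2 / 4) = exp (z ^ 2 / 4) * F"
    using kummer_transformation[OF three_halves_notin_nonpos_Ints, of "z ^ 2 / 4" "1 / 2"] by (simp add: F_def)
  finally have int: "(LINT x|lborel. f x) = z / 2 * (exp (z ^ 2 / 4) * F) / of_real s + planck_transform z s" .
  have erf: "complex_erf (z / 2) = z / complex_of_real (sqrt pi) * F"
    by (simp add: complex_erf_eq_kummer F_def power_divide)
  have ex: "exp (- (z ^ 2) / 8) * exp (z ^ 2 / 4) = exp (z ^ 2 / 8)"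
    by (simp flip: exp_add)
  have "\<alpha> powr (1 / 4) = \<alpha> powr (- 1 / 4) * s"
    using \<alpha> by (simp add: s_def powr_half_sqrt[symmetric] powr_add[symmetric])
  then have pw: "complex_of_real (\<alpha> powr (1 / 4)) / of_real s = of_real (\<alpha> powr (- 1 / 4))"
    using s by simp
  have pi: "complex_of_real (sqrt pi) \<noteq> 0" by simp
  have "K z \<alpha> = complex_of_real (sqrt pi) / z * of_real (\<alpha> powr (- 1 / 4)) * exp (z ^ 2 / 8) * (z / complex_of_real (sqrt pi) * F)
     - 4 / z * of_real (\<alpha> powr (1 / 4)) * exp (- (z ^ 2) / 8)
       * (z / 2 * (exp (z ^ 2 / 4) * F) / of_real s + planck_transform z s)"
    unfolding K_def erf int[symmetric] f_def set_lebesgue_integral_def ..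
  also have "\<dots> = of_real (\<alpha> powr (- 1 / 4)) * exp (z ^ 2 / 8) * F
     - 2 * (of_real (\<alpha> powr (1 / 4)) / of_real s) * (exp (- (z ^ 2) / 8) * exp (z ^ 2 / 4)) * F
     - 4 / z * of_real (\<alpha> powr (1 / 4)) * exp (- (z ^ 2) / 8) * planck_transform z s"
    using z pi by (simp add: distrib_left)
  finally show ?thesis unfolding ex pw by (simp add: F_def s_def)
qed

text \<open>A spare factor x tends to 0. This form serves both the scale condition and the
  remainder.\<close>

lemma smallo_at_right_0I:
  assumes "\<And>x. x > 0 \<Longrightarrow> norm (f x) \<le> R * x * norm (g x)"
  shows "f \<in> o[at_right (0::real)](g)"
proof (rule landau_o.smallI)
  fix c :: real assume "c > 0"
  have "((\<lambda>x. R * x) \<longlongrightarrow> R * 0) (at_right 0)" by (intro tendsto_intros)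
  then have "eventually (\<lambda>x. R * x < c) (at_right 0)"
    using \<open>c > 0\<close> by (intro order_tendstoD) auto
  moreover have "eventually (\<lambda>x. x > 0) (at_right (0::real))" by (rule eventually_at_right_less)
  ultimately show "eventually (\<lambda>x. norm (f x) \<le> c * norm (g x)) (at_right 0)"
  proof eventually_elim
    case (elim x)
    then show ?case using assms[of x] mult_right_mono[of "R * x" c "norm (g x)"] by simp
  qed
qed

theorem theorem4p1:
  fixes z :: complex
  assumes "z \<noteq> 0"
  shows "poincare_expansion (at_right (0::real))
           (\<lambda>m \<alpha>. 2 / complex_of_real (sqrt pi) * complex_of_real (\<alpha> powr (- 1 / 4)) * exp (z ^ 2 / 8)
                    * complex_of_real ((- \<alpha> / pi ^ 2) ^ m))
           (K z)
           (\<lambda>m. riemann_zeta (of_nat (2 * m)) * Gamma (of_nat m + 1 / 2)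
                  * kummer_1F1 (of_nat m + 1 / 2) (3 / 2) (- (z ^ 2) / 4))"
proof -
  define \<phi> where "\<phi> = (\<lambda>m \<alpha>. 2 / complex_of_real (sqrt pi) * complex_of_real (\<alpha> powr (- 1 / 4)) * exp (z ^ 2 / 8)
                    * complex_of_real ((- \<alpha> / pi ^ 2) ^ m))"
  define a where "a = (\<lambda>m. riemann_zeta (of_nat (2 * m)) * Gamma (of_nat m + 1 / 2)
                  * kummer_1F1 (of_nat m + 1 / 2) (3 / 2) (- (z ^ 2) / 4))"
  have "asymptotic_scale (at_right 0) \<phi>"
    unfolding asymptotic_scale_def
  proof (intro conjI allI)
    fix m
    show "eventually (\<lambda>\<alpha>. \<phi> m \<alpha> \<noteq> 0) (at_right 0)"
      using eventually_at_right_less[of "0 :: real"] by eventually_elim (simp add: \<phi>_def)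
    show "\<phi> (Suc m) \<in> o[at_right 0](\<phi> m)"
      by (rule smallo_at_right_0I[where R = "1 / pi ^ 2"])
        (simp add: \<phi>_def norm_mult norm_divide norm_power power_divide mult_ac)
  qed
  moreover have "(\<lambda>\<alpha>. K z \<alpha> - (\<Sum>m\<le>N. a m * \<phi> m \<alpha>)) \<in> o[at_right 0](\<phi> N)" for N
  proof -
    \<comment> \<open>The N Taylor terms k < N are the terms m = 1, ..., N. With s = sqrt \<alpha>,
      the error s ^ (2 N + 1) times the prefactor \<alpha> powr (1/4) = \<alpha> powr (-1/4) * s is
      \<alpha> powr (-1/4) * \<alpha> ^ (N + 1), one power of \<alpha> beyond the scale function of
      index N.\<close>
    obtain C where C: "\<And>s. s > 0 \<Longrightarrow>
        norm (planck_transform z s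
            - (\<Sum>k<N. gauss_sinh_coeff z k * of_real s ^ (2 * k + 1) * of_real (planck_moment k)))
          \<le> C * s ^ (2 * N + 1)"
      using planck_transform_expansion[of z N] by blast
    \<comment> \<open>\<open>E\<close> and \<open>D\<close> collect the factors of
      \<open>norm (\<phi> N \<alpha>)\<close> and of \<open>norm B\<close> that are independent of
      \<alpha>.\<close>
    define E where "E = norm (2 / complex_of_real (sqrt pi) * exp (z ^ 2 / 8)) / (pi ^ 2) ^ N"
    define D where "D = norm (4 / z * exp (- (z ^ 2) / 8))"
    have E: "E > 0" by (simp add: E_def)
    show ?thesis
    proof (rule smallo_at_right_0I[where R = "D * C / E"])
      fix \<alpha> :: real assume \<alpha>: "\<alpha> > 0"
      define s where "s = sqrt \<alpha>"
      define B where "B = 4 / z * of_real (\<alpha> powr (1 / 4)) * exp (- (z ^ 2) / 8)"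
      have s: "s > 0" "s ^ 2 = \<alpha>" using \<alpha> by (simp_all add: s_def)
      have pw: "\<alpha> powr (1 / 4) = \<alpha> powr (- 1 / 4) * s"
        using \<alpha> by (simp add: s_def powr_half_sqrt[symmetric] powr_add[symmetric])
      \<comment> \<open>The value \<zeta>(0) = -1/2 together with Gamma(1/2) = sqrt pi gives the
        coefficient -1 found in \<open>K_eq\<close>.\<close>
      have a0: "a 0 * \<phi> 0 \<alpha> = - (of_real (\<alpha> powr (- 1 / 4)) * exp (z ^ 2 / 8) * kummer_1F1 (1 / 2) (3 / 2) (- (z ^ 2) / 4))"
        by (simp add: a_def \<phi>_def riemann_zeta_0 Gamma_one_half_complex)
      \<comment> \<open>The signs of (-\<alpha>) ^ (k + 1) and of the terminating series combine to
        -1. The 4 in \<open>B\<close> cancels one factor of 4 ^ (k + 1) from (2 pi) ^ (2 k +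
        2).\<close>
      have aS: "a (Suc k) * \<phi> (Suc k) \<alpha>
          = - B * (gauss_sinh_coeff z k * of_real s ^ (2 * k + 1) * of_real (planck_moment k))" for k
      proof -
        define Z where "Z = riemann_zeta (of_nat (2 * Suc k))"
        define P where "P = complex_of_real (pi ^ 2)"
        define A where "A = complex_of_real \<alpha>"
        have P: "P \<noteq> 0" by (simp add: P_def)
        have m: "of_real (planck_moment k) = fact (2 * k + 1) / (4 ^ Suc k * P ^ Suc k) * Z"
          unfolding planck_moment Z_def P_def
          by (simp only: power_mult power_mult_distrib of_real_mult of_real_power) (simp add: power_mult_distrib)
        have sp: "complex_of_real s ^ (2 * k + 1) * of_real s = A ^ Suc k"
          unfolding A_def s(2)[symmetric] by (simp add: power_mult power2_eq_square power_mult_distrib)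
        have "a (Suc k) * \<phi> (Suc k) \<alpha> = Z * of_real (\<alpha> powr (- 1 / 4)) * (- A / P) ^ Suc k
           * (2 / complex_of_real (sqrt pi) * exp (z ^ 2 / 8)
     * (Gamma (of_nat (Suc k) + 1 / 2) * kummer_1F1 (of_nat (Suc k) + 1 / 2) (3 / 2) (- (z ^ 2) / 4)))"
          unfolding a_def \<phi>_def Z_def A_def P_def by (simp only: of_real_power of_real_divide of_real_minus mult_ac)
        also have "\<dots> = Z * of_real (\<alpha> powr (- 1 / 4)) * (- A / P) ^ Suc k
           * ((- 1) ^ k * (exp (- (z ^ 2) / 8) * fact (2 * k + 1) / 4 ^ k * gauss_sinh_coeff z k / z))"
          unfolding coefficient_match[OF assms] ..
        also have "(- A / P) ^ Suc k = - ((- 1) ^ k * A ^ Suc k / P ^ Suc k)"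
          by (simp only: power_divide power_minus[of A "Suc k"]) simp
        also have "Z * of_real (\<alpha> powr (- 1 / 4)) * - ((- 1) ^ k * A ^ Suc k / P ^ Suc k)
           * ((- 1) ^ k * (exp (- (z ^ 2) / 8) * fact (2 * k + 1) / 4 ^ k * gauss_sinh_coeff z k / z))
          = - (((- 1) ^ k * (- 1) ^ k) * (Z * of_real (\<alpha> powr (- 1 / 4)) * A ^ Suc k / P ^ Suc k
           * (exp (- (z ^ 2) / 8) * fact (2 * k + 1) / 4 ^ k * gauss_sinh_coeff z k / z)))"
          by (simp add: mult_ac del: fact_Suc power_Suc)
        also have "(- 1) ^ k * (- 1) ^ k = (1 :: complex)" by (simp flip: power_mult_distrib)
        also have "- (1 * (Z * of_real (\<alpha> powr (- 1 / 4)) * A ^ Suc k / P ^ Suc k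
           * (exp (- (z ^ 2) / 8) * fact (2 * k + 1) / 4 ^ k * gauss_sinh_coeff z k / z)))
          = - B * (gauss_sinh_coeff z k * of_real s ^ (2 * k + 1) * of_real (planck_moment k))"
          unfolding m sp[symmetric] B_def pw of_real_mult using assms P
          by (simp add: field_simps del: fact_Suc)
        finally show ?thesis .
      qed
      have "K z \<alpha> - (\<Sum>m\<le>N. a m * \<phi> m \<alpha>) = - B * (planck_transform z s
          - (\<Sum>k<N. gauss_sinh_coeff z k * of_real s ^ (2 * k + 1) * of_real (planck_moment k)))"
        unfolding sum.atMost_shift a0 aS K_eq[OF assms \<alpha>] s_def[symmetric] B_def[symmetric]
        by (simp add: right_diff_distrib sum_distrib_left sum_negf)
      then have "norm (K z \<alpha> - (\<Sum>m\<le>N. a m * \<phi> m \<alpha>)) \<le> norm B * (C * s ^ (2 * N + 1))"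
        using C[OF s(1)] by (simp add: norm_mult mult_left_mono)
      also have "norm B = D * (\<alpha> powr (- 1 / 4) * s)"
        unfolding B_def D_def pw[symmetric] by (simp add: norm_mult norm_divide)
      also have "D * (\<alpha> powr (- 1 / 4) * s) * (C * s ^ (2 * N + 1)) = D * C * \<alpha> * (\<alpha> powr (- 1 / 4) * \<alpha> ^ N)"
        unfolding s(2)[symmetric] by (simp add: power_mult power_mult_distrib power2_eq_square mult_ac)
      also have "\<alpha> powr (- 1 / 4) * \<alpha> ^ N = norm (\<phi> N \<alpha>) / E"
        using \<alpha> E by (simp add: \<phi>_def E_def norm_mult norm_divide norm_power power_divide field_simps)
      finally show "norm (K z \<alpha> - (\<Sum>m\<le>N. a m * \<phi> m \<alpha>)) \<le> D * C / E * \<alpha> * norm (\<phi> N \<alpha>)"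
        by simp
    qed
  qed
  ultimately show ?thesis unfolding poincare_expansion_def \<phi>_def a_def by blast
qed

end
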